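(* Let $\ell\ge3$. A partition $\lambda$ is an $(\ell,0)$-JM partition if and only if it is a generalized $\ell$-partition.
   Context: Young diagrams in English notation; $(a,b)$ is the box in row $a$, column $b$. The hook length $h^\lambda_{(a,b)}$ is the number of boxes of $\lambda$ in row $a$ weakly right of $(a,b)$ plus those in column $b$ strictly below $(a,b)$. A partition $\lambda$ is an $(\ell,0)$-JM partition if there do not exist boxes $(a,b),(a,y),(x,b)$ of $\lambda$ with $\ell\mid h^\lambda_{(a,b)}$, $\ell\nmid h^\lambda_{(a,y)}$ and $\ell\nmid h^\lambda_{(x,b)}$. A removable $\ell$-rim hook of $\lambda$ is a connected set of $\ell$ boxes of $\lambda$ on its rim containing no $2\times2$ square whose removal leaves a partition. It is horizontal if contained in a single row and vertical if contained in a single column. Two sets of boxes are adjacent if some box of one shares an edge with some box of the other. A partition $\lambda$ is a generalized $\ell$-partition if: (1) every removable $\ell$-rim hook of $\lambda$ is horizontal or vertical; (2) whenever $R$ is a vertical (resp. horizontal) removable $\ell$-rim hook of $\lambda$ and $S$ is a horizontal (resp. vertical) removable $\ell$-rim hook of $\lambda\setminus R$, $R$ and $S$ are not adjacent; (3) after removing any sequence of horizontal and vertical removable $\ell$-rim hooks from $\lambda$, the remaining partition satisfies (1) and (2). *)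

theory Defs
  imports Main
begin

type_synonym box = "nat \<times> nat"

definition is_partition :: "nat list \<Rightarrow> bool" where
  "is_partition p \<longleftrightarrow> sorted_wrt (\<ge>) p \<and> 0 \<notin> set p"

text \<open>English notation: \<open>(a, b)\<close> is the box in row \<open>a\<close>, column \<open>b\<close>, both counted from 1.
  The notions below are stated for the set of boxes of a partition, so that removing a rim hook
  is set difference.\<close>

definition diagram :: "nat list \<Rightarrow> box set" where
  "diagram p = {(a, b). 1 \<le> a \<and> a \<le> length p \<and> 1 \<le> b \<and> b \<le> p ! (a - 1)}"

definition young_diagram :: "box set \<Rightarrow> bool" where
  "young_diagram D \<longleftrightarrow> (\<exists>p. is_partition p \<and> D = diagram p)"

definition hook_length :: "box set \<Rightarrow> nat \<Rightarrow> nat \<Rightarrow> nat" where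
  "hook_length D a b = card {y. b \<le> y \<and> (a, y) \<in> D} + card {x. a < x \<and> (x, b) \<in> D}"

definition JM_partition :: "nat \<Rightarrow> box set \<Rightarrow> bool" where
  "JM_partition l D \<longleftrightarrow>
     \<not> (\<exists>a b x y. (a, b) \<in> D \<and> (a, y) \<in> D \<and> (x, b) \<in> D \<and>
          l dvd hook_length D a b \<and> \<not> l dvd hook_length D a y \<and> \<not> l dvd hook_length D x b)"

definition share_edge :: "box \<Rightarrow> box \<Rightarrow> bool" where
  "share_edge u v \<longleftrightarrow>
     (fst u = fst v \<and> (snd u = Suc (snd v) \<or> snd v = Suc (snd u))) \<or>
     (snd u = snd v \<and> (fst u = Suc (fst v) \<or> fst v = Suc (fst u)))"

definition adjacent :: "box set \<Rightarrow> box set \<Rightarrow> bool" where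
  "adjacent R S \<longleftrightarrow> (\<exists>u\<in>R. \<exists>v\<in>S. share_edge u v)"

definition connected_boxes :: "box set \<Rightarrow> bool" where
  "connected_boxes R \<longleftrightarrow>
     (\<forall>u\<in>R. \<forall>v\<in>R. (\<lambda>s t. s \<in> R \<and> t \<in> R \<and> share_edge s t)\<^sup>*\<^sup>* u v)"

definition rim :: "box set \<Rightarrow> box set" where
  "rim D = {(a, b) \<in> D. (Suc a, Suc b) \<notin> D}"

definition removable_rim_hook :: "nat \<Rightarrow> box set \<Rightarrow> box set \<Rightarrow> bool" where
  "removable_rim_hook l D R \<longleftrightarrow>
     R \<subseteq> rim D \<and> finite R \<and> card R = l \<and> connected_boxes R \<and>
     \<not> (\<exists>a b. {(a, b), (Suc a, b), (a, Suc b), (Suc a, Suc b)} \<subseteq> R) \<and>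
     young_diagram (D - R)"

definition horizontal :: "box set \<Rightarrow> bool" where
  "horizontal R \<longleftrightarrow> (\<exists>a. \<forall>u\<in>R. fst u = a)"

definition vertical :: "box set \<Rightarrow> bool" where
  "vertical R \<longleftrightarrow> (\<exists>b. \<forall>u\<in>R. snd u = b)"

definition hooks_straight :: "nat \<Rightarrow> box set \<Rightarrow> bool" where
  "hooks_straight l D \<longleftrightarrow> (\<forall>R. removable_rim_hook l D R \<longrightarrow> horizontal R \<or> vertical R)"

definition hooks_nonadjacent :: "nat \<Rightarrow> box set \<Rightarrow> bool" where
  "hooks_nonadjacent l D \<longleftrightarrow>
     (\<forall>R S. removable_rim_hook l D R \<and> removable_rim_hook l (D - R) S \<and>
            (vertical R \<and> horizontal S \<or> horizontal R \<and> vertical S) \<longrightarrow> \<not> adjacent R S)"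

definition remove_straight_hook :: "nat \<Rightarrow> box set \<Rightarrow> box set \<Rightarrow> bool" where
  "remove_straight_hook l D E \<longleftrightarrow>
     (\<exists>R. removable_rim_hook l D R \<and> (horizontal R \<or> vertical R) \<and> E = D - R)"

definition generalized_partition :: "nat \<Rightarrow> box set \<Rightarrow> bool" where
  "generalized_partition l D \<longleftrightarrow>
     hooks_straight l D \<and> hooks_nonadjacent l D \<and>
     (\<forall>E. (remove_straight_hook l)\<^sup>*\<^sup>* D E \<longrightarrow> hooks_straight l E \<and> hooks_nonadjacent l E)"

end

theory Submission
  imports Defs
begin

text \<open>Encode a partition by its abacus: walking along the boundary of the diagram, each row
  contributes a bead and each column a gap at an integer position. A box is a pair of a bead and a
  gap at a smaller position, and its hook length is their distance. Removing an \<open>l\<close>-rim hook moves a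
  bead from \<open>x\<close> to a gap at \<open>x - l\<close>; the hook is horizontal (vertical) if all positions strictly between
  are gaps (beads). The JM condition says that for a bead \<open>x\<close> and a gap \<open>y < x\<close> on the same
  runner (residue class modulo \<open>l\<close>), all gaps below \<open>x\<close> or all beads above \<open>y\<close> are on that runner.

  The JM condition survives every move and excludes both non-straight hooks and adjacent hooks of
  different directions. Conversely, if it fails while all hooks are straight and no two such hooks
  are adjacent, then some straight hook can be removed so that it still fails; by induction on the
  number of boxes a generalized \<open>l\<close>-partition satisfies it.\<close>

section \<open>The abacus\<close>

text \<open>The gaps below \<open>x\<close> stand for the boxes in the row of \<open>x\<close>, the
  beads above \<open>y\<close> for the boxes in the column of \<open>y\<close>; the differences are
  the hook lengths compared in the JM condition.\<close>

definition abacus_JM :: "nat \<Rightarrow> int set \<Rightarrow> bool" where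
  "abacus_JM l B \<longleftrightarrow>
     (\<forall>x y. x \<in> B \<and> y \<notin> B \<and> y < x \<and> int l dvd x - y \<longrightarrow>
       (\<forall>g<x. g \<notin> B \<longrightarrow> int l dvd x - g) \<or> (\<forall>b>y. b \<in> B \<longrightarrow> int l dvd b - y))"

lemma abacus_JM_E:
  assumes "abacus_JM l B" "x \<in> B" "y \<notin> B" "y < x" "int l dvd x - y"
  obtains "\<forall>g<x. g \<notin> B \<longrightarrow> int l dvd x - g" | "\<forall>b>y. b \<in> B \<longrightarrow> int l dvd b - y"
  using assms unfolding abacus_JM_def by blast

definition movable :: "nat \<Rightarrow> int set \<Rightarrow> int \<Rightarrow> bool" where
  "movable l B x \<longleftrightarrow> x \<in> B \<and> x - int l \<notin> B"

definition move :: "nat \<Rightarrow> int set \<Rightarrow> int \<Rightarrow> int set" where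
  "move l B x = insert (x - int l) (B - {x})"

definition over_gaps :: "nat \<Rightarrow> int set \<Rightarrow> int \<Rightarrow> bool" where
  "over_gaps l B x \<longleftrightarrow> (\<forall>n. x - int l < n \<and> n < x \<longrightarrow> n \<notin> B)"

definition over_beads :: "nat \<Rightarrow> int set \<Rightarrow> int \<Rightarrow> bool" where
  "over_beads l B x \<longleftrightarrow> (\<forall>n. x - int l < n \<and> n < x \<longrightarrow> n \<in> B)"

definition abacus_straight :: "nat \<Rightarrow> int set \<Rightarrow> bool" where
  "abacus_straight l B \<longleftrightarrow> (\<forall>x. movable l B x \<longrightarrow> over_gaps l B x \<or> over_beads l B x)"

text \<open>Conjugating the partition reverses the abacus and exchanges beads with gaps.\<close>

definition dual :: "int set \<Rightarrow> int set" where
  "dual B = {n. - n \<notin> B}"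

lemma mem_dual [simp]: "n \<in> dual B \<longleftrightarrow> - n \<notin> B"
  by (simp add: dual_def)

lemma dual_dual [simp]: "dual (dual B) = B"
  by (auto simp: dual_def)

text \<open>Reversal turns the beads above \<open>- x\<close> into the gaps below \<open>x\<close>,
  so the two alternatives of the condition are interchanged.\<close>

lemma abacus_JM_dual_imp: "abacus_JM l (dual B)" if "abacus_JM l B"
  unfolding abacus_JM_def
proof (intro allI impI)
  fix x y assume *: "x \<in> dual B \<and> y \<notin> dual B \<and> y < x \<and> int l dvd x - y"
  then have yx: "- y \<in> B" "- x \<notin> B" "- x < - y" "int l dvd - y - - x" by simp_all
  from that yx show "(\<forall>g<x. g \<notin> dual B \<longrightarrow> int l dvd x - g) \<or> (\<forall>b>y. b \<in> dual B \<longrightarrow> int l dvd b - y)"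
  proof (cases rule: abacus_JM_E)
    case 1
    have "int l dvd b - y" if "b > y" "b \<in> dual B" for b
      using 1[rule_format, of "- b"] that by simp
    then show ?thesis by blast
  next
    case 2
    have "int l dvd x - g" if "g < x" "g \<notin> dual B" for g
      using 2[rule_format, of "- g"] that by simp
    then show ?thesis by blast
  qed
qed

lemma abacus_JM_dual [simp]: "abacus_JM l (dual B) \<longleftrightarrow> abacus_JM l B"
  using abacus_JM_dual_imp[of l B] abacus_JM_dual_imp[of l "dual B"] by auto

text \<open>A move from \<open>x\<close> to \<open>x - int l\<close> in \<open>dual B\<close> is,
  read in \<open>B\<close>, the move of the bead at \<open>int l - x\<close> to the gap at
  \<open>- x\<close>; hence the argument \<open>int l - x\<close> here and below.\<close>

lemma movable_dual: "movable l (dual B) x \<longleftrightarrow> movable l B (int l - x)"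
  by (auto simp: movable_def)

lemma move_dual: "move l (dual B) x = dual (move l B (int l - x))" if "l \<noteq> 0"
  using that by (auto simp: move_def dual_def)

lemma over_gaps_dual: "over_gaps l (dual B) x \<longleftrightarrow> over_beads l B (int l - x)"
proof -
  have "(\<forall>n. x - int l < n \<and> n < x \<longrightarrow> - n \<in> B) \<longleftrightarrow>
        (\<forall>n. - x < n \<and> n < int l - x \<longrightarrow> n \<in> B)" (is "?L \<longleftrightarrow> ?R")
  proof
    assume L: ?L
    show ?R
    proof (intro allI impI)
      fix n assume "- x < n \<and> n < int l - x"
      then show "n \<in> B" using L[rule_format, of "- n"] by simp
    qed
  next
    assume R: ?R
    show ?L
    proof (intro allI impI)
      fix n assume "x - int l < n \<and> n < x"
      then show "- n \<in> B" using R[rule_format, of "- n"] by simp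
    qed
  qed
  then show ?thesis by (simp add: over_gaps_def over_beads_def)
qed

lemma over_beads_dual: "over_beads l (dual B) x \<longleftrightarrow> over_gaps l B (int l - x)"
  using over_gaps_dual[of l "dual B" "int l - x"] by simp

lemma abacus_straight_dual: "abacus_straight l (dual B)" if "abacus_straight l B"
  using that by (auto simp: abacus_straight_def movable_dual over_gaps_dual over_beads_dual)

section \<open>Moves and straight hooks under the JM condition\<close>

text \<open>A pair of a bead and a gap after the move is compared with a pair before the move that
  encloses it and lies on the same runner.\<close>

lemma abacus_JM_move:
  assumes "abacus_JM l B" "movable l B z" "l \<noteq> 0"
  shows "abacus_JM l (move l B z)"
  unfolding abacus_JM_def
proof (intro allI impI)
  define w where "w = z - int l"
  have w: "w < z" "z \<in> B" "w \<notin> B" "int l dvd z - w" "w \<noteq> z"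
    using assms by (auto simp: w_def movable_def)
  have mem: "n \<in> move l B z \<longleftrightarrow> n = w \<or> n \<in> B \<and> n \<noteq> z" for n
    by (auto simp: move_def w_def)
  fix x y
  assume "x \<in> move l B z \<and> y \<notin> move l B z \<and> y < x \<and> int l dvd x - y"
  then have *: "x = w \<or> x \<in> B \<and> x \<noteq> z" "y \<noteq> w" "y = z \<or> y \<notin> B" "y < x" "int l dvd x - y"
    by (auto simp: mem)
  \<comment> \<open>Undoing the move sends the new bead \<open>w\<close> back to \<open>z\<close>
    and the new gap \<open>z\<close> back to \<open>w\<close>: the bead can only rise, the gap can
    only fall, and residues are kept.\<close>
  define x' where "x' = (if x = w then z else x)"
  define y' where "y' = (if y = z then w else y)"
  have x'y': "x' \<in> B" "y' \<notin> B" "y' < x'" "x \<le> x'" "y' \<le> y"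
    using * w by (auto simp: x'_def y'_def)
  have dx: "int l dvd x' - x" using w by (simp add: x'_def)
  have dy: "int l dvd y - y'" using w by (simp add: y'_def)
  have "int l dvd x' - y'"
    using dvd_add[OF dvd_add[OF dx *(5)] dy] by simp
  from assms(1) x'y'(1-3) this show "(\<forall>g<x. g \<notin> move l B z \<longrightarrow> int l dvd x - g) \<or>
             (\<forall>b>y. b \<in> move l B z \<longrightarrow> int l dvd b - y)"
  proof (cases rule: abacus_JM_E)
    case 1
    have "int l dvd x - g" if "g < x" "g \<notin> move l B z" for g
    proof -
      have "int l dvd x' - g"
      proof (cases "g \<in> B")
        case True
        \<comment> \<open>Only \<open>z\<close> has become a gap; the old gap \<open>w\<close> on
          its runner lies below it and answers for it.\<close>
        then have "g = z" using that mem by auto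
        then have "int l dvd x' - w" using 1[rule_format, of w] w that x'y' by auto
        then have "int l dvd (x' - w) - (z - w)" using w dvd_diff by blast
        then show ?thesis using \<open>g = z\<close> by simp
      next
        case False
        then show ?thesis using 1[rule_format, of g] that x'y' by auto
      qed
      then show ?thesis using dvd_diff[OF _ dx, of "x' - g"] by simp
    qed
    then show ?thesis by blast
  next
    case 2
    have "int l dvd b - y" if "b > y" "b \<in> move l B z" for b
    proof -
      have "int l dvd b - y'"
      proof (cases "b \<in> B")
        case False
        \<comment> \<open>Only \<open>w\<close> has become a bead; the old bead \<open>z\<close> on
          its runner lies above it and answers for it.\<close>
        then have "b = w" using that mem by auto
        then have "int l dvd z - y'" using 2[rule_format, of z] w that x'y' by auto
        then have "int l dvd (z - y') - (z - w)" using w dvd_diff by blast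
        then show ?thesis using \<open>b = w\<close> by simp
      next
        case True
        then show ?thesis using 2[rule_format, of b] that x'y' by auto
      qed
      then show ?thesis using dvd_diff[OF _ dy, of "b - y'"] by simp
    qed
    then show ?thesis by blast
  qed
qed

lemma not_dvd_between: "\<not> int l dvd n" if "0 < n" "n < int l"
  using that zdvd_not_zless by blast

text \<open>The condition is applied to the pair \<open>x\<close>, \<open>x - int l\<close>. No
  position strictly between them is on their runner, so one alternative excludes gaps there and the
  other excludes beads.\<close>

lemma abacus_JM_imp_straight:
  assumes "abacus_JM l B" "l \<noteq> 0"
  shows "abacus_straight l B"
  unfolding abacus_straight_def
proof (intro allI impI)
  fix x assume m: "movable l B x"
  then have "x \<in> B" "x - int l \<notin> B" "x - int l < x" "int l dvd x - (x - int l)"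
    using assms(2) by (auto simp: movable_def)
  with assms(1) show "over_gaps l B x \<or> over_beads l B x"
  proof (cases rule: abacus_JM_E)
    case 1
    then have "over_beads l B x"
      unfolding over_beads_def using not_dvd_between[of "x - _" l] by fastforce
    then show ?thesis ..
  next
    case 2
    then have "over_gaps l B x"
      unfolding over_gaps_def using not_dvd_between[of "_ - (x - int l)" l] by fastforce
    then show ?thesis ..
  qed
qed

section \<open>Moves that leave a violated JM condition violated\<close>

lemma abacus_JM_contra:
  assumes "abacus_JM l B" "x \<in> B" "y \<notin> B" "y < x" "int l dvd x - y"
    "g < x" "g \<notin> B" "\<not> int l dvd x - g" "y < b" "b \<in> B" "\<not> int l dvd b - y"
  shows False
  using assms unfolding abacus_JM_def by blast

text \<open>The least bead \<open>z\<close> above \<open>y\<close> on another runner can be moved past gaps only, and it stays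
  above \<open>x\<close>; otherwise \<open>x\<close> would lie strictly between \<open>z - l\<close> and \<open>z\<close> among gaps.\<close>

lemma nonJM_move_gaps:
  assumes l: "l \<ge> 3" and st: "abacus_straight l B" and x: "movable l B x" "over_gaps l B x"
    and b: "b \<in> B" "b > x - int l" "\<not> int l dvd b - x"
  shows "\<exists>z. movable l B z \<and> over_gaps l B z \<and> \<not> abacus_JM l (move l B z)"
proof -
  define y where "y = x - int l"
  have xy: "x \<in> B" "y \<notin> B" and gaps: "\<And>n. y < n \<Longrightarrow> n < x \<Longrightarrow> n \<notin> B"
    using x by (auto simp: y_def movable_def over_gaps_def)
  define P where "P z \<longleftrightarrow> z \<in> B \<and> y < z \<and> \<not> int l dvd z - x" for z
  \<comment> \<open>The distance from \<open>y\<close> turns the search for a least integer into one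
    over the naturals.\<close>
  have "\<exists>z. P z \<and> (\<forall>w. P w \<longrightarrow> nat (z - y) \<le> nat (w - y))"
    using ex_has_least_nat[of P b "\<lambda>z. nat (z - y)"] b by (auto simp: P_def y_def)
  then obtain z where Pz: "P z" and min: "\<And>w. P w \<Longrightarrow> nat (z - y) \<le> nat (w - y)"
    by blast
  have min': "z \<le> w" if "P w" for w
    using min[OF that] that Pz by (auto simp: P_def)
  have z: "z \<in> B" "y < z" "\<not> int l dvd z - x" using Pz by (auto simp: P_def)
  have "z \<noteq> x" using z by auto
  with gaps[of z] z have zx: "z > x" by force
  have nd: "\<not> int l dvd (z - int l) - x"
  proof
    assume "int l dvd (z - int l) - x"
    then have "int l dvd (z - int l) - x + int l" using dvd_add dvd_refl by blast
    then show False using z by simp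
  qed
  \<comment> \<open>Since \<open>z > x\<close>, the position \<open>z - int l\<close> is above
    \<open>y\<close>, and it shares the runner of \<open>z\<close>; a bead there would contradict
    minimality.\<close>
  have "z - int l \<notin> B"
    using min'[of "z - int l"] nd zx l by (auto simp: P_def y_def)
  then have mz: "movable l B z" using z by (simp add: movable_def)
  \<comment> \<open>One of \<open>z - 1\<close> and \<open>z - 2\<close> is off the runner of
    \<open>x\<close>, hence a gap by minimality; both lie strictly between \<open>z - int l\<close>
    and \<open>z\<close> because \<open>l \<ge> 3\<close>.\<close>
  have btw: "\<exists>n. z - int l < n \<and> n < z \<and> n \<notin> B"
  proof (cases "int l dvd (z - 1) - x")
    case False
    then have "\<not> P (z - 1)" using min'[of "z - 1"] by auto
    with False have "z - 1 \<notin> B" using zx xy l by (auto simp: P_def y_def)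
    then show ?thesis using l by (intro exI[of _ "z - 1"]) auto
  next
    case True
    have "\<not> int l dvd (z - 2) - x"
    proof
      assume "int l dvd (z - 2) - x"
      then have "int l dvd ((z - 1) - x) - ((z - 2) - x)" using True dvd_diff by blast
      then show False using l by simp
    qed
    moreover have "\<not> P (z - 2)" using min'[of "z - 2"] by auto
    ultimately have "z - 2 \<notin> B" using zx xy l by (auto simp: P_def y_def)
    then show ?thesis using l by (intro exI[of _ "z - 2"]) auto
  qed
  then have "\<not> over_beads l B z" by (auto simp: over_beads_def)
  then have gz: "over_gaps l B z" using st mz by (auto simp: abacus_straight_def)
  have zlx: "z - int l > x"
  proof (rule ccontr)
    assume "\<not> z - int l > x"
    moreover have "z - int l \<noteq> x" using z by auto
    ultimately show False using gz zx xy by (auto simp: over_gaps_def)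
  qed
  have "\<not> abacus_JM l (move l B z)"
  proof
    assume J: "abacus_JM l (move l B z)"
    show False
    \<comment> \<open>The pair \<open>x\<close>, \<open>y\<close> survives the move. The gap off the
      runner is \<open>x - 1\<close>, over which \<open>x\<close> can move, and the bead off the
      runner is the moved one.\<close>
    proof (rule abacus_JM_contra[OF J, of x y "x - 1" "z - int l"])
      show "\<not> int l dvd z - int l - y"
      proof
        assume "int l dvd z - int l - y"
        then show False using z by (simp add: y_def)
      qed
      show "\<not> int l dvd x - (x - 1)" using l by simp
      show "x - 1 \<notin> move l B z" using gaps[of "x - 1"] zlx l by (auto simp: move_def y_def)
    qed (use xy zlx l zx in \<open>auto simp: move_def y_def\<close>)
  qed
  then show ?thesis using mz gz by blast
qed

text \<open>The conjugate of \<open>nonJM_move_gaps\<close>: the bead \<open>int l - x\<close> of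
  \<open>dual B\<close> moves over gaps, and \<open>- g\<close> is the bead off its runner.\<close>

lemma nonJM_move_beads:
  assumes l: "l \<ge> 3" and st: "abacus_straight l B" and x: "movable l B x" "over_beads l B x"
    and g: "g \<notin> B" "g < x" "\<not> int l dvd x - g"
  shows "\<exists>z. movable l B z \<and> over_beads l B z \<and> \<not> abacus_JM l (move l B z)"
proof -
  have "\<exists>z. movable l (dual B) z \<and> over_gaps l (dual B) z \<and> \<not> abacus_JM l (move l (dual B) z)"
  proof (rule nonJM_move_gaps[OF l abacus_straight_dual[OF st], of "int l - x" "- g"])
    show "\<not> int l dvd - g - (int l - x)"
    proof
      assume "int l dvd - g - (int l - x)"
      then have "int l dvd - g - (int l - x) + int l" using dvd_add dvd_refl by blast
      then show False using g by simp
    qed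
  qed (use x g in \<open>auto simp: movable_dual over_gaps_dual\<close>)
  then show ?thesis
    using l by (auto simp: movable_dual over_gaps_dual move_dual)
qed

text \<open>Whatever occupies the middle position \<open>x - l\<close>, two hooks can be removed from this
  pattern one after the other, one horizontal and one vertical, and they are adjacent.\<close>

definition cross_pattern :: "nat \<Rightarrow> int set \<Rightarrow> int \<Rightarrow> bool" where
  "cross_pattern l B x \<longleftrightarrow> x \<in> B \<and> x - 2 * int l \<notin> B \<and>
     over_gaps l B x \<and> over_beads l B (x - int l)"

text \<open>For a violating pair \<open>x\<close>, \<open>y\<close> at minimal distance, at least \<open>2 l\<close>, moving \<open>x\<close> to \<open>x - l\<close> or
  \<open>y + l\<close> to \<open>y\<close> must destroy the violation. Off the runner of \<open>x\<close> this leaves only beads below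
  \<open>x - l\<close> and only gaps above \<open>y + l\<close>, so the distance is \<open>2 l\<close> and the cross pattern occurs.\<close>

lemma nonJM_pair:
  assumes l: "l \<ge> 3" and st: "abacus_straight l B" and cr: "\<And>x. \<not> cross_pattern l B x"
    and "x \<in> B" "y \<notin> B" "y < x" "int l dvd x - y"
    "g < x" "g \<notin> B" "\<not> int l dvd x - g" "y < b" "b \<in> B" "\<not> int l dvd b - y"
  shows "\<exists>z. movable l B z \<and> (over_gaps l B z \<or> over_beads l B z) \<and> \<not> abacus_JM l (move l B z)"
    (is ?thesis)
  using assms(4-)
proof (induction "nat (x - y)" arbitrary: x y g b rule: less_induct)
  case less
  note p = less.prems
  show ?case
  proof (rule ccontr)
    assume no: "\<not> ?thesis"
    have dvd_cong: "int l dvd n - c \<longleftrightarrow> int l dvd n - c'" if "int l dvd c - c'" for n c c'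
      using dvd_diff[of "int l" "n - c'" "c - c'"] dvd_add[of "int l" "n - c" "c - c'"] that by auto
    have dvd_cong': "int l dvd c - n \<longleftrightarrow> int l dvd c' - n" if "int l dvd c - c'" for n c c'
      using dvd_cong[OF that, of n] by (metis dvd_minus_iff minus_diff_eq)
    \<comment> \<open>By the induction hypothesis and \<open>no\<close>, a closer pair on a common
      runner does not violate the condition.\<close>
    have good: "(\<forall>g<x'. g \<notin> B \<longrightarrow> int l dvd x' - g) \<or> (\<forall>b>y'. b \<in> B \<longrightarrow> int l dvd b - y')"
      if "x' \<in> B" "y' \<notin> B" "y' < x'" "int l dvd x' - y'" "x' - y' < x - y" for x' y'
      using less.hyps[of x' y'] that no by auto
    \<comment> \<open>The contrapositives of the two preceding lemmas, again because of
      \<open>no\<close>.\<close>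
    have hook: "over_gaps l B z \<Longrightarrow> b' \<in> B \<Longrightarrow> b' > z - int l \<Longrightarrow> int l dvd b' - z"
      "over_beads l B z \<Longrightarrow> g' \<notin> B \<Longrightarrow> g' < z \<Longrightarrow> int l dvd z - g'"
      if "movable l B z" for z b' g'
      using nonJM_move_gaps[OF l st that] nonJM_move_beads[OF l st that] no by blast+
    have dbx: "\<not> int l dvd b - x" using p dvd_cong[of x y b] by simp
    have dyg: "\<not> int l dvd y - g" using p dvd_cong'[of x y g] by simp
    obtain k where k: "x - y = int l * k" using p by (metis dvdE)
    have k0: "k > 0"
    proof -
      have "0 < int l * k" using k p(3) by simp
      then show ?thesis using l by (simp add: zero_less_mult_iff)
    qed
    \<comment> \<open>At distance \<open>l\<close> the bead \<open>x\<close> itself is movable and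
      straight, and \<open>b\<close> or \<open>g\<close> contradicts \<open>hook\<close>.\<close>
    have k1: "k \<noteq> 1"
    proof
      assume "k = 1"
      then have y: "y = x - int l" using k by simp
      then have m: "movable l B x" using p by (auto simp: movable_def)
      then show False
        using hook(1)[OF m, of b] hook(2)[OF m, of g] p dbx st m y
        unfolding abacus_straight_def by blast
    qed
    have "2 * int l \<le> int l * k"
      using mult_left_mono[of 2 k "int l"] k0 k1 by simp
    then have xy2: "y + 2 * int l \<le> x" using k by simp
    \<comment> \<open>A gap \<open>n\<close> off the runner below \<open>x - int l\<close> would,
      together with \<open>b\<close>, make \<open>x - int l\<close>, \<open>y\<close> a violating
      pair: a closer one in \<open>B\<close> if \<open>x - int l\<close> is a bead, otherwise one
      after moving \<open>x\<close> there.\<close>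
    have low: "n \<in> B" if "n < x - int l" "\<not> int l dvd x - n" for n
    proof (rule ccontr)
      assume n: "n \<notin> B"
      have d: "int l dvd x - int l - y" "int l dvd x - (x - int l)" 
        using p(4) dvd_diff[of "int l" "x - y" "int l"] by (simp_all add: algebra_simps)
      have d': "\<not> int l dvd x - int l - n" using that dvd_cong'[OF d(2), of n] by simp
      show False
      proof (cases "x - int l \<in> B")
        case True
        then show False
          using good[of "x - int l" y] d d' n p that xy2 l by auto
      next
        case False
        then have m: "movable l B x" using p by (simp add: movable_def)
        have "over_gaps l B x \<or> over_beads l B x" using st m by (simp add: abacus_straight_def)
        moreover have "\<not> abacus_JM l (move l B x)"
        proof
          assume J: "abacus_JM l (move l B x)"
          show False
            by (rule abacus_JM_contra[OF J, of "x - int l" y n b])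
              (use p xy2 l d d' n that dbx in \<open>auto simp: move_def\<close>)
        qed
        ultimately show False using m no by blast
      qed
    qed
    \<comment> \<open>The mirror image, with the pair \<open>x\<close>, \<open>y + int l\<close>: if
      \<open>y + int l\<close> is a gap, the pair is closer; if it is a bead, moving it to
      \<open>y\<close> leaves a gap behind.\<close>
    have high: "n \<notin> B" if "n > y + int l" "\<not> int l dvd n - y" for n
    proof
      assume n: "n \<in> B"
      have d: "int l dvd x - (y + int l)" "int l dvd (y + int l) - y" 
        using p(4) dvd_diff[of "int l" "x - y" "int l"] by (simp_all add: algebra_simps)
      have d': "\<not> int l dvd n - (y + int l)" using that dvd_cong[OF d(2), of n] by simp
      show False
      proof (cases "y + int l \<in> B")
        case False
        then show False
          using good[of x "y + int l"] d d' n p that xy2 l by auto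
      next
        case True
        then have m: "movable l B (y + int l)" using p by (simp add: movable_def)
        have "over_gaps l B (y + int l) \<or> over_beads l B (y + int l)"
          using st m by (simp add: abacus_straight_def)
        moreover have "\<not> abacus_JM l (move l B (y + int l))"
        proof
          assume J: "abacus_JM l (move l B (y + int l))"
          show False
            by (rule abacus_JM_contra[OF J, of x "y + int l" g n])
              (use p xy2 l d d' n that dyg in \<open>auto simp: move_def\<close>)
        qed
        ultimately show False using m no by blast
      qed
    qed
    have nd1: "\<not> int l dvd y + int l + 1 - y" "\<not> int l dvd x - (y + int l + 1)"
    proof -
      show "\<not> int l dvd y + int l + 1 - y" using l by simp
      then show "\<not> int l dvd x - (y + int l + 1)"
        using dvd_cong'[OF p(4), of "y + int l + 1"] by (metis dvd_minus_iff minus_diff_eq)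
    qed
    \<comment> \<open>Otherwise \<open>y + int l + 1\<close>, which is off the runner, would be a
      bead by \<open>low\<close> and a gap by \<open>high\<close>. This bounds the distance below
      \<open>3 * int l\<close>.\<close>
    have "\<not> y + int l + 1 < x - int l" using low high nd1 by force
    have "\<not> 3 \<le> k"
    proof
      assume "3 \<le> k"
      then have "3 * int l \<le> int l * k" using mult_left_mono[of 3 k "int l"] by simp
      then show False using \<open>\<not> y + int l + 1 < x - int l\<close> k l by linarith
    qed
    then have "k = 2" using k0 k1 by simp
    then have xk: "y = x - 2 * int l" using k by simp
    have "over_gaps l B x"
      unfolding over_gaps_def
    proof (intro allI impI)
      fix n assume n: "x - int l < n \<and> n < x"
      then have "\<not> int l dvd x - n" using not_dvd_between[of "x - n" l] by simp
      then have "\<not> int l dvd n - y" using dvd_cong'[OF p(4), of n] by (metis dvd_minus_iff minus_diff_eq)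
      then show "n \<notin> B" using high[of n] n xk by simp
    qed
    moreover have "over_beads l B (x - int l)"
      unfolding over_beads_def
    proof (intro allI impI)
      fix n assume n: "x - int l - int l < n \<and> n < x - int l"
      then have "\<not> int l dvd n - y" using not_dvd_between[of "n - y" l] xk by simp
      then have "\<not> int l dvd x - n" using dvd_cong'[OF p(4), of n] by (metis dvd_minus_iff minus_diff_eq)
      then show "n \<in> B" using low[of n] n by simp
    qed
    ultimately show False using cr[of x] p xk by (simp add: cross_pattern_def)
  qed
qed

section \<open>Boundary profiles of diagrams\<close>

lemma initial_segment_card:
  assumes "finite S" "0 \<notin> S" "\<And>n. 1 \<le> n \<Longrightarrow> Suc n \<in> S \<Longrightarrow> n \<in> S"
  shows "S = {1..card S}"
proof -
  have down: "n - k \<in> S" if "n \<in> S" "k < n" for n k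
    using that
  proof (induction k)
    case (Suc k)
    then show ?case using assms(3)[of "n - Suc k"] by (simp add: Suc_diff_Suc)
  qed simp
  have sub: "{1..n} \<subseteq> S" if "n \<in> S" for n
  proof
    fix m assume "m \<in> {1..n}"
    then show "m \<in> S" using down[OF that, of "n - m"] by auto
  qed
  show ?thesis
  proof (cases "S = {}")
    case False
    then have "Max S \<in> S" "S \<subseteq> {1..Max S}"
      using assms by (auto intro!: Suc_leI) (metis neq0_conv)
    then have "S = {1..Max S}" using sub by blast
    then show ?thesis by (metis card_atLeastAtMost diff_Suc_1)
  qed simp
qed

text \<open>Young diagrams as finite order ideals of boxes, without reference to a list of parts.
  The guards \<open>1 \<le> a\<close> and \<open>1 \<le> b\<close> keep the closure from leaving the
  quadrant, where indices start at 1.\<close>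

definition lower_set :: "box set \<Rightarrow> bool" where
  "lower_set D \<longleftrightarrow> finite D \<and> (\<forall>a b. (a, b) \<in> D \<longrightarrow> 1 \<le> a \<and> 1 \<le> b) \<and>
     (\<forall>a b. 1 \<le> a \<longrightarrow> (Suc a, b) \<in> D \<longrightarrow> (a, b) \<in> D) \<and>
     (\<forall>a b. 1 \<le> b \<longrightarrow> (a, Suc b) \<in> D \<longrightarrow> (a, b) \<in> D)"

lemma lower_setD:
  assumes "lower_set D"
  shows "finite D" "(a, b) \<in> D \<Longrightarrow> 1 \<le> a" "(a, b) \<in> D \<Longrightarrow> 1 \<le> b"
    "1 \<le> a \<Longrightarrow> (Suc a, b) \<in> D \<Longrightarrow> (a, b) \<in> D"
    "1 \<le> b \<Longrightarrow> (a, Suc b) \<in> D \<Longrightarrow> (a, b) \<in> D"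
  using assms unfolding lower_set_def by blast+

definition row_len :: "box set \<Rightarrow> nat \<Rightarrow> nat" where
  "row_len D a = card {b. (a, b) \<in> D}"

definition col_len :: "box set \<Rightarrow> nat \<Rightarrow> nat" where
  "col_len D b = card {a. (a, b) \<in> D}"

lemma finite_row: "finite {b. (a, b) \<in> D}" if "finite D" for D :: "box set"
  using finite_vimageI[OF that, of "Pair a"] by (simp add: vimage_def inj_on_def)

lemma finite_col: "finite {a. (a, b) \<in> D}" if "finite D" for D :: "box set"
  using finite_vimageI[OF that, of "\<lambda>a. (a, b)"] by (simp add: vimage_def inj_on_def)

lemma row_eq: "{b. (a, b) \<in> D} = {1..row_len D a}" if "lower_set D"
  unfolding row_len_def
proof (rule initial_segment_card)
  show "finite {b. (a, b) \<in> D}" using finite_row[OF lower_setD(1)[OF that]] .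
  show "0 \<notin> {b. (a, b) \<in> D}" using lower_setD(2,3)[OF that, of a 0] by auto
qed (use lower_setD(4,5)[OF that] in blast)

lemma col_eq: "{a. (a, b) \<in> D} = {1..col_len D b}" if "lower_set D"
  unfolding col_len_def
proof (rule initial_segment_card)
  show "finite {a. (a, b) \<in> D}" using finite_col[OF lower_setD(1)[OF that]] .
  show "0 \<notin> {a. (a, b) \<in> D}" using lower_setD(2,3)[OF that, of 0 b] by auto
qed (use lower_setD(4,5)[OF that] in blast)

lemma mem_row: "(a, b) \<in> D \<longleftrightarrow> 1 \<le> b \<and> b \<le> row_len D a" if "lower_set D"
  using row_eq[OF that, of a] unfolding set_eq_iff by simp

lemma mem_col: "(a, b) \<in> D \<longleftrightarrow> 1 \<le> a \<and> a \<le> col_len D b" if "lower_set D"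
  using col_eq[OF that, of b] unfolding set_eq_iff by simp

lemma young_diagram_imp_lower_set:
  assumes "young_diagram D"
  shows "lower_set D"
proof -
  obtain p where p: "is_partition p" and D: "D = diagram p"
    using assms by (auto simp: young_diagram_def)
  have mem: "(a, b) \<in> D \<longleftrightarrow> 1 \<le> a \<and> a \<le> length p \<and> 1 \<le> b \<and> b \<le> p ! (a - 1)" for a b
    by (simp add: D diagram_def)
  then have "D = (SIGMA a:{1..length p}. {1..p ! (a - 1)})" by auto
  then have "finite D" by simp
  moreover have "(a, b) \<in> D" if "1 \<le> a" "(Suc a, b) \<in> D" for a b
  proof -
    have a: "a - 1 < a" "a < length p" "1 \<le> b" "b \<le> p ! a" using that by (simp_all add: mem)
    then have "p ! a \<le> p ! (a - 1)"
      using p unfolding is_partition_def sorted_wrt_iff_nth_less by blast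
    then show ?thesis using a \<open>1 \<le> a\<close> by (simp add: mem)
  qed
  moreover have "1 \<le> a \<and> 1 \<le> b" if "(a, b) \<in> D" for a b
    using that by (simp add: mem)
  moreover have "(a, b) \<in> D" if "1 \<le> b" "(a, Suc b) \<in> D" for a b
    using that by (simp add: mem)
  ultimately show ?thesis unfolding lower_set_def by blast
qed

lemma lower_set_imp_young_diagram: "young_diagram D" if D: "lower_set D"
proof -
  \<comment> \<open>The first column has one box in each nonempty row, so its length is the number
    of parts.\<close>
  define m where "m = col_len D 1"
  define p where "p = map (row_len D) [1..<Suc m]"
  have nth: "p ! i = row_len D (Suc i)" if "i < m" for i
    using that by (simp add: p_def del: upt_Suc)
  have len: "length p = m" by (simp add: p_def)
  have mono: "row_len D (a + k) \<le> row_len D a" if "1 \<le> a" for a k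
  proof (induction k)
    case (Suc k)
    have "row_len D (Suc (a + k)) \<le> row_len D (a + k)"
      unfolding row_len_def
    proof (rule card_mono)
      show "finite {b. (a + k, b) \<in> D}" using finite_row[OF lower_setD(1)[OF D]] .
      show "{b. (Suc (a + k), b) \<in> D} \<subseteq> {b. (a + k, b) \<in> D}"
        using lower_setD(4)[OF D] that by (simp add: subset_iff)
    qed
    with Suc show ?case by simp
  qed simp
  have pos: "row_len D a > 0" if "1 \<le> a" "a \<le> m" for a
    using that mem_row[OF D, of a 1] mem_col[OF D, of a 1] by (simp add: m_def)
  have "sorted_wrt (\<ge>) p"
    unfolding sorted_wrt_iff_nth_less
  proof (intro allI impI)
    fix i j assume "i < j" "j < length p"
    then show "p ! j \<le> p ! i"
      using mono[of "Suc i" "j - i"] by (simp add: nth len)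
  qed
  moreover have "0 \<notin> set p" using pos by (fastforce simp: p_def)
  moreover have "D = diagram p"
  proof (intro set_eqI; clarify)
    fix a b
    have "(a, b) \<in> D \<Longrightarrow> a \<le> m"
    proof -
      assume ab: "(a, b) \<in> D"
      then have "(a, 1) \<in> D" using mem_row[OF D, of a b] mem_row[OF D, of a 1] by auto
      then show "a \<le> m" using mem_col[OF D, of a 1] by (simp add: m_def)
    qed
    moreover have "(a, b) \<in> D \<Longrightarrow> 1 \<le> a" by (rule lower_setD(2)[OF D])
    moreover have "(a, b) \<in> diagram p \<longleftrightarrow> 1 \<le> a \<and> a \<le> m \<and> 1 \<le> b \<and> b \<le> row_len D a"
      using nth[of "a - 1"] by (cases a) (auto simp: diagram_def len)
    ultimately show "(a, b) \<in> D \<longleftrightarrow> (a, b) \<in> diagram p"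
      using mem_row[OF D, of a b] by blast
  qed
  ultimately show ?thesis by (auto simp: young_diagram_def is_partition_def)
qed

lemma young_diagram_iff_lower_set: "young_diagram D \<longleftrightarrow> lower_set D"
  using young_diagram_imp_lower_set lower_set_imp_young_diagram by blast

text \<open>The boundary of a diagram is a lattice path crossing each diagonal \<open>b - a = n\<close> once, at the
  corner with coordinates \<open>(A n, A n + n)\<close>. Its step from diagonal \<open>n\<close> to \<open>n + 1\<close> is vertical
  (a bead, one per row) or horizontal (a gap, one per column).\<close>

definition profile :: "box set \<Rightarrow> (int \<Rightarrow> int) \<Rightarrow> bool" where
  "profile D A \<longleftrightarrow>
     (\<forall>n. 0 \<le> A n \<and> 0 \<le> A n + n \<and> A (n + 1) \<le> A n \<and> A n \<le> A (n + 1) + 1) \<and>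
     (\<forall>a b. (a, b) \<in> D \<longleftrightarrow> 1 \<le> a \<and> 1 \<le> b \<and> int a \<le> A (int b - int a))"

definition beads :: "(int \<Rightarrow> int) \<Rightarrow> int set" where
  "beads A = {n. A (n + 1) < A n}"

lemma lower_set_ge:
  assumes D: "lower_set D" and "(a', b') \<in> D" "1 \<le> a" "1 \<le> b" "a \<le> a'" "b \<le> b'"
  shows "(a, b) \<in> D"
proof -
  have "(a', b) \<in> D" using assms mem_row[OF D, of a'] by auto
  then show ?thesis using assms mem_col[OF D, of _ b] by auto
qed

text \<open>The corner on diagonal \<open>n\<close> is the first point \<open>(k, k + n)\<close> of
  the quadrant whose lower right box is outside \<open>D\<close>. It exists because the diagonal is
  infinite and \<open>D\<close> is finite.\<close>

lemma profile_exists: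
  assumes D: "lower_set D"
  shows "\<exists>A. profile D A"
proof -
  define Q where "Q n k \<longleftrightarrow> 0 \<le> int k + n \<and> (Suc k, nat (int k + n + 1)) \<notin> D" for n k
  define A where "A n = (LEAST k. Q n k)" for n
  have ex: "\<exists>k. Q n k" for n
  proof (rule ccontr)
    assume *: "\<nexists>k. Q n k"
    have "(\<lambda>k. (Suc k, nat (int k + n + 1))) ` {nat (- n)..} \<subseteq> D"
    proof clarify
      fix k assume "nat (- n) \<le> k"
      then have "0 \<le> int k + n" by simp
      then show "(Suc k, nat (int k + n + 1)) \<in> D" using * unfolding Q_def by blast
    qed
    moreover have "infinite ((\<lambda>k. (Suc k, nat (int k + n + 1))) ` {nat (- n)..})"
    proof
      assume "finite ((\<lambda>k. (Suc k, nat (int k + n + 1))) ` {nat (- n)..})"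
      then have "finite {nat (- n)..}" by (rule finite_imageD) (simp add: inj_on_def)
      then show False using infinite_Ici by blast
    qed
    ultimately show False using lower_setD(1)[OF D] finite_subset by blast
  qed
  have Q: "Q n (A n)" for n unfolding A_def using ex LeastI_ex by blast
  have least: "A n \<le> k" if "Q n k" for n k unfolding A_def using that by (rule Least_le)
  \<comment> \<open>Being outside \<open>D\<close> is inherited by boxes further down and
    right.\<close>
  have Qmono: "Q n' k'" if "Q n k" "k \<le> k'" "int k + n \<le> int k' + n'"
    for n n' k k'
  proof -
    have "(Suc k, nat (int k + n + 1)) \<in> D" if "(Suc k', nat (int k' + n' + 1)) \<in> D"
    proof (rule lower_set_ge[OF D that])
      show "1 \<le> nat (int k + n + 1)" using \<open>Q n k\<close> unfolding Q_def by linarith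
      show "nat (int k + n + 1) \<le> nat (int k' + n' + 1)"
        using \<open>int k + n \<le> int k' + n'\<close> by simp
    qed (use \<open>k \<le> k'\<close> in simp_all)
    then show ?thesis using that unfolding Q_def by linarith
  qed
  have "profile D (\<lambda>n. int (A n))"
    unfolding profile_def
  proof (intro conjI allI)
    fix n
    show "0 \<le> int (A n)" by simp
    show "0 \<le> int (A n) + n" using Q[of n] by (simp add: Q_def)
    \<comment> \<open>One step to the right from the corner on diagonal \<open>n\<close> reaches
      diagonal \<open>n + 1\<close>; one step down from the corner on \<open>n + 1\<close> reaches
      diagonal \<open>n\<close>. Both points satisfy \<open>Q\<close>, and the corners are
      least.\<close>
    show "int (A (n + 1)) \<le> int (A n)"
      using least[OF Qmono[OF Q[of n], of "A n" "n + 1"]] by simp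
    show "int (A n) \<le> int (A (n + 1)) + 1"
      using least[OF Qmono[OF Q[of "n + 1"], of "Suc (A (n + 1))" n]] by simp
  next
    fix a b
    show "((a, b) \<in> D) = (1 \<le> a \<and> 1 \<le> b \<and> int a \<le> int (A (int b - int a)))"
    proof (cases "1 \<le> a \<and> 1 \<le> b")
      case False
      then show ?thesis using lower_setD(2,3)[OF D] by blast
    next
      case True
      define n where "n = int b - int a"
      have "(a, b) \<notin> D \<longleftrightarrow> Q n (a - 1)"
        using True by (auto simp: Q_def n_def)
      moreover have "Q n (a - 1) \<longleftrightarrow> A n \<le> a - 1"
        using least[of n "a - 1"] Qmono[OF Q[of n], of "a - 1" n] by auto
      ultimately show ?thesis using True unfolding n_def[symmetric] by auto
    qed
  qed
  then show ?thesis by blast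
qed

lemma profile_lower_set:
  assumes "profile D A" "finite D"
  shows "lower_set D"
proof -
  have step: "A (n + 1) \<le> A n" "A n \<le> A (n + 1) + 1" for n
    using assms unfolding profile_def by blast+
  have mem: "(a, b) \<in> D \<longleftrightarrow> 1 \<le> a \<and> 1 \<le> b \<and> int a \<le> A (int b - int a)" for a b
    using assms unfolding profile_def by blast+
  have "(a, b) \<in> D" if "1 \<le> a" "(Suc a, b) \<in> D" for a b
    using that step(2)[of "int b - int (Suc a)"] by (auto simp: mem)
  moreover have "(a, b) \<in> D" if "1 \<le> b" "(a, Suc b) \<in> D" for a b
    using that step(1)[of "int b - int a"] by (auto simp: mem algebra_simps)
  ultimately show ?thesis using assms mem unfolding lower_set_def by blast
qed

lemma young_diagram_iff_profile: "young_diagram D \<longleftrightarrow> finite D \<and> (\<exists>A. profile D A)"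
  using profile_exists[of D] profile_lower_set[of D] lower_setD(1)[of D]
  unfolding young_diagram_iff_lower_set by metis

lemma profileD:
  assumes "profile D A"
  shows "0 \<le> A n" "0 \<le> A n + n" "A (n + 1) \<le> A n" "A n \<le> A (n + 1) + 1"
  using assms unfolding profile_def by blast+

lemma profile_mem:
  assumes "profile D A"
  shows "(a, b) \<in> D \<longleftrightarrow> 1 \<le> a \<and> 1 \<le> b \<and> int a \<le> A (int b - int a)"
  using assms unfolding profile_def by blast+

text \<open>The boundary path only goes up and to the right.\<close>

lemma profile_mono:
  assumes "profile D A" "m \<le> n"
  shows "A n \<le> A m" "A m + m \<le> A n + n"
proof -
  have "A (m + int k) \<le> A m \<and> A m + m \<le> A (m + int k) + (m + int k)" for k
  proof (induction k)
    case (Suc k)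
    then show ?case using profileD(3,4)[OF assms(1), of "m + int k"] by (simp add: algebra_simps)
  qed simp
  from this[of "nat (n - m)"] show "A n \<le> A m" "A m + m \<le> A n + n" using assms(2) by simp_all
qed

lemma profile_beadD: "A (n + 1) = A n - 1" if "profile D A" "n \<in> beads A"
  using profileD(4)[OF that(1), of n] that(2) by (simp add: beads_def)

lemma profile_gapD: "A (n + 1) = A n" if "profile D A" "n \<notin> beads A"
  using profileD(3)[OF that(1), of n] that(2) by (simp add: beads_def)

text \<open>Serves to show that a diagram determines its profile: if \<open>u\<close> and
  \<open>v\<close> differed, the box of diagonal \<open>n\<close> in row \<open>max u v\<close>
  would separate them.\<close>

lemma profile_diagonal_unique:
  assumes "0 \<le> u" "0 \<le> u + n" "0 \<le> v" "0 \<le> v + n"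
    and "\<And>a b. int b - int a = n \<Longrightarrow> 1 \<le> a \<Longrightarrow> 1 \<le> b \<Longrightarrow> int a \<le> u \<longleftrightarrow> int a \<le> v"
  shows "u = (v :: int)"
proof (rule ccontr)
  assume ne: "u \<noteq> v"
  define m where "m = max u v"
  have m: "1 \<le> m" "1 \<le> m + n" using ne assms(1-4) by (auto simp: m_def)
  then have "m \<le> u \<longleftrightarrow> m \<le> v"
    using assms(5)[of "nat (m + n)" "nat m"] by (simp add: nat_le_iff le_nat_iff)
  then show False using ne by (simp add: m_def max_def split: if_splits)
qed

section \<open>Boxes as pairs of a bead and a smaller gap\<close>

text \<open>The first bracket is the position of the bead of row \<open>a\<close>, the second that
  of the gap of column \<open>b\<close>.\<close>

lemma hook_length_eq:
  assumes D: "lower_set D" and ab: "(a, b) \<in> D"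
  shows "int (hook_length D a b) = (int (row_len D a) - int a) - (int b - 1 - int (col_len D b))"
proof -
  have a: "1 \<le> a" "a \<le> col_len D b" and b: "1 \<le> b" "b \<le> row_len D a"
    using mem_row[OF D, of a b] mem_col[OF D, of a b] ab by blast+
  have "{y. b \<le> y \<and> (a, y) \<in> D} = {b..row_len D a}"
    unfolding mem_row[OF D] using b(1) by auto
  moreover have "{x. a < x \<and> (x, b) \<in> D} = {Suc a..col_len D b}"
    unfolding mem_col[OF D] using a(1) by auto
  ultimately show ?thesis using a b by (simp add: hook_length_def Suc_diff_le)
qed

text \<open>The edge closing row \<open>a\<close> on the right climbs from the corner
  \<open>(a, r)\<close> to \<open>(a - 1, r)\<close>, where \<open>r\<close> is the row length, so
  its step starts on diagonal \<open>r - a\<close>.\<close>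

lemma row_bead:
  assumes D: "lower_set D" and A: "profile D A" and ab: "(a, b) \<in> D"
  shows "int (row_len D a) - int a \<in> beads A"
proof -
  have "(a, row_len D a) \<in> D" "(a, Suc (row_len D a)) \<notin> D" "1 \<le> a"
    using mem_row[OF D, of a] ab profile_mem[OF A, of a b] by auto
  then show ?thesis by (auto simp: beads_def profile_mem[OF A] algebra_simps)
qed

text \<open>The edge closing column \<open>b\<close> below runs from the corner
  \<open>(c, b - 1)\<close> to \<open>(c, b)\<close>, where \<open>c\<close> is the column length;
  the start of this step explains the \<open>- 1\<close>.\<close>

lemma col_gap:
  assumes D: "lower_set D" and A: "profile D A" and ab: "(a, b) \<in> D"
  shows "int b - 1 - int (col_len D b) \<notin> beads A"
proof -
  define c where "c = col_len D b"
  have "(c, b) \<in> D" "(Suc c, b) \<notin> D" "1 \<le> b"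
    using mem_col[OF D, of _ b] ab profile_mem[OF A, of a b] by (auto simp: c_def)
  then have c: "int c \<le> A (int b - int c)" "\<not> int (Suc c) \<le> A (int b - int (Suc c))"
    unfolding profile_mem[OF A] by simp_all
  define n where "n = int b - 1 - int c"
  have n: "int b - int (Suc c) = n" "int b - int c = n + 1" by (simp_all add: n_def)
  have "A n \<le> A (n + 1)" using c unfolding n by simp
  then show ?thesis by (simp add: beads_def n_def c_def)
qed

text \<open>The inverse correspondence: the vertical step at \<open>x\<close> closes row
  \<open>A x\<close>, and the horizontal step at \<open>y\<close> closes column
  \<open>A y + y + 1\<close>.\<close>

lemma bead_gap_box:
  assumes D: "lower_set D" and A: "profile D A" and xy: "x \<in> beads A" "y \<notin> beads A" "y < x"
  defines "a \<equiv> nat (A x)" and "b \<equiv> nat (A y + y + 1)"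
  shows "(a, b) \<in> D" "int (row_len D a) - int a = x" "int b - 1 - int (col_len D b) = y"
proof -
  note bead = profile_beadD[OF A xy(1)] and gap = profile_gapD[OF A xy(2)]
  have a: "int a = A x" "1 \<le> a"
    using bead profileD(1)[OF A, of "x + 1"] by (simp_all add: a_def)
  have b: "int b = A y + y + 1" "1 \<le> b"
    using profileD(2)[OF A, of y] by (simp_all add: b_def)
  define n where "n = int b - int a"
  \<comment> \<open>On a diagonal up to \<open>x\<close> the row is compared with that of the step
    at \<open>x\<close>; on a later one, the column is compared with that of the step at
    \<open>y\<close>.\<close>
  have "int a \<le> A n"
  proof (cases "n \<le> x")
    case True
    then show ?thesis using profile_mono(1)[OF A True] a by simp
  next
    case False
    then show ?thesis using profile_mono(2)[OF A, of "y + 1" n] xy gap b by (simp add: n_def)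
  qed
  then show ab: "(a, b) \<in> D" using a b by (simp add: profile_mem[OF A] n_def)
  have ax: "1 \<le> A x + x" using profile_mono(2)[OF A, of "y + 1" x] xy gap b by simp
  have "(a, nat (A x + x)) \<in> D" "(a, nat (A x + x + 1)) \<notin> D"
    using a ax bead by (simp_all add: profile_mem[OF A] algebra_simps)
  then have "row_len D a = nat (A x + x)" using ax unfolding mem_row[OF D] by linarith
  then show "int (row_len D a) - int a = x" using ax a by simp
  have ay: "1 \<le> A y" using profile_mono(1)[OF A, of y x] xy a by simp
  have "(nat (A y), b) \<in> D" "(nat (A y + 1), b) \<notin> D"
    using b ay gap by (simp_all add: profile_mem[OF A] algebra_simps)
  then have "col_len D b = nat (A y)" using ay unfolding mem_col[OF D] by linarith
  then show "int b - 1 - int (col_len D b) = y" using ay b by simp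
qed

section \<open>Rim hooks as bead moves\<close>

text \<open>Boxes of one row share their bead, boxes of one column share their gap, and the hook
  length is the difference, so witnesses translate both ways.\<close>

lemma JM_partition_iff_abacus_JM:
  assumes D: "lower_set D" and A: "profile D A"
  shows "JM_partition l D \<longleftrightarrow> abacus_JM l (beads A)"
proof
  assume J: "JM_partition l D"
  show "abacus_JM l (beads A)"
  proof (rule ccontr)
    assume "\<not> abacus_JM l (beads A)"
    then obtain x y g b where xy: "x \<in> beads A" "y \<notin> beads A" "y < x" "int l dvd x - y"
      and g: "g < x" "g \<notin> beads A" "\<not> int l dvd x - g"
      and b: "y < b" "b \<in> beads A" "\<not> int l dvd b - y"
      unfolding abacus_JM_def by blast
    define row where "row u = nat (A u)" for u
    define col where "col v = nat (A v + v + 1)" for v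
    have box: "(row u, col v) \<in> D \<and> (l dvd hook_length D (row u) (col v) \<longleftrightarrow> int l dvd u - v)"
      if "u \<in> beads A" "v \<notin> beads A" "v < u" for u v
    proof -
      note in_D = bead_gap_box(1)[OF D A that, folded row_def col_def]
      have "int (hook_length D (row u) (col v)) = u - v"
        using hook_length_eq[OF D in_D] bead_gap_box(2,3)[OF D A that]
        unfolding row_def col_def by linarith
      then show ?thesis using in_D by (metis int_dvd_int_iff)
    qed
    show False
      using J box[OF xy(1-3)] box[OF xy(1) g(2,1)] box[OF b(2) xy(2) b(1)] xy(4) g(3) b(3)
      unfolding JM_partition_def by metis
  qed
next
  assume J: "abacus_JM l (beads A)"
  define r where "r a = int (row_len D a) - int a" for a
  define c where "c b = int b - 1 - int (col_len D b)" for b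
  have box: "r a \<in> beads A \<and> c b \<notin> beads A \<and> c b < r a \<and>
      (l dvd hook_length D a b \<longleftrightarrow> int l dvd r a - c b)" if "(a, b) \<in> D" for a b
  proof -
    have h: "int (hook_length D a b) = r a - c b"
      unfolding r_def c_def by (rule hook_length_eq[OF D that])
    have "l dvd hook_length D a b \<longleftrightarrow> int l dvd r a - c b"
      unfolding h[symmetric] int_dvd_int_iff ..
    moreover have "c b < r a"
      using that mem_row[OF D, of a b] mem_col[OF D, of a b] unfolding r_def c_def by linarith
    ultimately show ?thesis
      using row_bead[OF D A that] col_gap[OF D A that] unfolding r_def c_def by blast
  qed
  show "JM_partition l D"
    unfolding JM_partition_def
  proof clarify
    fix a b x y
    assume *: "(a, b) \<in> D" "(a, y) \<in> D" "(x, b) \<in> D" "l dvd hook_length D a b"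
      "\<not> l dvd hook_length D a y" "\<not> l dvd hook_length D x b"
    have "r a \<in> beads A" "c b \<notin> beads A" "c b < r a" "int l dvd r a - c b"
      "c y < r a" "c y \<notin> beads A" "\<not> int l dvd r a - c y"
      "c b < r x" "r x \<in> beads A" "\<not> int l dvd r x - c b"
      using box[OF *(1)] box[OF *(2)] box[OF *(3)] *(4-6) by blast+
    then show False by (rule abacus_JM_contra[OF J])
  qed
qed

text \<open>The boxes removed when the bead at \<open>x\<close> moves to \<open>x - l\<close>: the last box on each of the diagonals
  \<open>x - l + 1, ..., x\<close>, on which the boundary path is then lowered by one.\<close>

definition strip :: "nat \<Rightarrow> (int \<Rightarrow> int) \<Rightarrow> int \<Rightarrow> box set" where
  "strip l A x = (\<lambda>n. (nat (A n), nat (A n + n))) ` {x - int l<..x}"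

definition lowered :: "nat \<Rightarrow> (int \<Rightarrow> int) \<Rightarrow> int \<Rightarrow> int \<Rightarrow> int" where
  "lowered l A x n = (if x - int l < n \<and> n \<le> x then A n - 1 else A n)"

lemma mem_strip:
  assumes A: "profile D A"
  shows "(a, b) \<in> strip l A x \<longleftrightarrow>
    x - int l < int b - int a \<and> int b - int a \<le> x \<and> int a = A (int b - int a)"
proof
  assume "(a, b) \<in> strip l A x"
  then obtain n where n: "x - int l < n" "n \<le> x" "a = nat (A n)" "b = nat (A n + n)"
    by (auto simp: strip_def)
  then have "int a = A n" "int b = A n + n" using profileD(1,2)[OF A, of n] by simp_all
  then show "x - int l < int b - int a \<and> int b - int a \<le> x \<and> int a = A (int b - int a)"
    using n by simp
next
  assume *: "x - int l < int b - int a \<and> int b - int a \<le> x \<and> int a = A (int b - int a)"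
  then have "nat (A (int b - int a)) = a" "nat (A (int b - int a) + (int b - int a)) = b"
    by simp_all
  then show "(a, b) \<in> strip l A x"
    unfolding strip_def using * by (intro image_eqI[of _ _ "int b - int a"]) simp_all
qed

text \<open>The path still has to climb at \<open>x\<close>, so earlier corners are below row 0; it
  has already gone right at \<open>x - int l\<close>, so later corners are beyond column 0.\<close>

lemma strip_pos:
  assumes A: "profile D A" and m: "movable l (beads A) x" and n: "x - int l < n" "n \<le> x"
  shows "1 \<le> A n" "1 \<le> A n + n"
proof -
  show "1 \<le> A n"
    using profile_mono(1)[OF A n(2)] profile_beadD[OF A, of x] profileD(1)[OF A, of "x + 1"] m
    by (simp add: movable_def)
  show "1 \<le> A n + n"
    using profile_mono(2)[OF A, of "x - int l + 1" n] profile_gapD[OF A, of "x - int l"]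
      profileD(2)[OF A, of "x - int l"] m n
    by (simp add: movable_def)
qed

text \<open>Lowering a window of diagonals changes only the steps entering and leaving it: the gap
  at \<open>x - int l\<close> becomes a bead and the bead at \<open>x\<close> a gap.\<close>

lemma beads_lowered:
  assumes A: "profile D A" and m: "movable l (beads A) x" and l: "l \<noteq> 0"
  shows "beads (lowered l A x) = move l (beads A) x"
proof -
  have "n \<in> beads (lowered l A x) \<longleftrightarrow> n \<in> move l (beads A) x" for n
  proof -
    have b: "A (x + 1) = A x - 1" and g: "A (x - int l + 1) = A (x - int l)"
      using profile_beadD[OF A, of x] profile_gapD[OF A, of "x - int l"] m
      by (auto simp: movable_def)
    consider "n = x" | "n = x - int l" | "n \<noteq> x" "n \<noteq> x - int l" by blast
    then show ?thesis
    proof cases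
      case 1
      then show ?thesis using b l by (simp add: beads_def lowered_def move_def)
    next
      case 2
      then show ?thesis using g l by (simp add: beads_def lowered_def move_def)
    next
      case 3
      then have "lowered l A x (n + 1) < lowered l A x n \<longleftrightarrow> A (n + 1) < A n"
        by (simp add: lowered_def)
      then show ?thesis using 3 by (simp add: beads_def move_def)
    qed
  qed
  then show ?thesis by blast
qed

lemma profile_lowered:
  assumes A: "profile D A" and m: "movable l (beads A) x" and l: "l \<noteq> 0"
  shows "profile (D - strip l A x) (lowered l A x)"
  unfolding profile_def
proof (intro conjI allI)
  fix n
  have b: "A (x + 1) = A x - 1" and g: "A (x - int l + 1) = A (x - int l)"
    using profile_beadD[OF A, of x] profile_gapD[OF A, of "x - int l"] m
    by (auto simp: movable_def)
  note p = profileD[OF A, of n]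
  show "0 \<le> lowered l A x n" "0 \<le> lowered l A x n + n"
    using p(1,2) strip_pos[OF A m, of n] by (auto simp: lowered_def)
  consider "n = x" | "n = x - int l" | "n \<noteq> x" "n \<noteq> x - int l" by blast
  then have "lowered l A x (n + 1) \<le> lowered l A x n \<and>
      lowered l A x n \<le> lowered l A x (n + 1) + 1"
  proof cases
    case 3
    then have "lowered l A x (n + 1) - lowered l A x n = A (n + 1) - A n"
      by (simp add: lowered_def)
    then show ?thesis using p by simp
  qed (use b g l in \<open>simp_all add: lowered_def\<close>)
  then show "lowered l A x (n + 1) \<le> lowered l A x n"
    "lowered l A x n \<le> lowered l A x (n + 1) + 1" by blast+
next
  fix a b
  show "((a, b) \<in> D - strip l A x) =
      (1 \<le> a \<and> 1 \<le> b \<and> int a \<le> lowered l A x (int b - int a))"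
    unfolding Diff_iff mem_strip[OF A] profile_mem[OF A] lowered_def by auto
qed

section \<open>Removable rim hooks are exactly the strips of movable beads\<close>

lemma share_edge_commute: "share_edge u v \<longleftrightarrow> share_edge v u"
  unfolding share_edge_def by metis

lemma connected_boxes_chain:
  assumes "\<And>n. u \<le> n \<Longrightarrow> n < v \<Longrightarrow> share_edge (f n) (f (n + 1 :: int))"
  shows "connected_boxes (f ` {u..v})"
proof -
  define S where "S s t \<longleftrightarrow> s \<in> f ` {u..v} \<and> t \<in> f ` {u..v} \<and> share_edge s t" for s t
  have S_sym: "S t s" if "S s t" for s t
    using that share_edge_commute unfolding S_def by blast
  have chain: "S\<^sup>*\<^sup>* (f m) (f (m + int k)) \<and> S\<^sup>*\<^sup>* (f (m + int k)) (f m)"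
    if "u \<le> m" "m + int k \<le> v" for m k
    using that
  proof (induction k)
    case (Suc k)
    have e: "m + int (Suc k) = m + int k + 1" by simp
    have "S (f (m + int k)) (f (m + int (Suc k)))"
      using assms[of "m + int k"] Suc.prems unfolding e S_def by simp
    moreover have "S\<^sup>*\<^sup>* (f m) (f (m + int k)) \<and> S\<^sup>*\<^sup>* (f (m + int k)) (f m)"
      using Suc by simp
    ultimately show ?case
      using S_sym converse_rtranclp_into_rtranclp rtranclp.rtrancl_into_rtrancl by metis
  qed simp
  have "S\<^sup>*\<^sup>* (f m) (f n)" if "m \<in> {u..v}" "n \<in> {u..v}" for m n
  proof (cases "m \<le> n")
    case True
    then show ?thesis using chain[of m "nat (n - m)"] that by simp
  next
    case False
    then show ?thesis using chain[of n "nat (m - n)"] that by simp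
  qed
  then have "\<forall>s\<in>f ` {u..v}. \<forall>t\<in>f ` {u..v}. S\<^sup>*\<^sup>* s t" by blast
  then show ?thesis unfolding connected_boxes_def S_def .
qed

lemma strip_removable:
  assumes D: "lower_set D" and A: "profile D A" and m: "movable l (beads A) x" and l: "l \<noteq> 0"
  shows "removable_rim_hook l D (strip l A x)"
  unfolding removable_rim_hook_def
proof (intro conjI)
  let ?f = "\<lambda>n. (nat (A n), nat (A n + n))"
  show "strip l A x \<subseteq> rim D"
  proof clarify
    fix a b assume ab: "(a, b) \<in> strip l A x"
    then have *: "x - int l < int b - int a" "int b - int a \<le> x" "int a = A (int b - int a)"
      by (simp_all add: mem_strip[OF A])
    then have "1 \<le> a" "1 \<le> b" using strip_pos[OF A m *(1,2)] by simp_all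
    then show "(a, b) \<in> rim D" using * by (simp add: rim_def profile_mem[OF A])
  qed
  show "finite (strip l A x)" by (simp add: strip_def)
  have "inj_on ?f {x - int l<..x}"
  proof (rule inj_onI)
    fix n n' assume "?f n = ?f n'"
    then have "A n = A n'" "A n + n = A n' + n'"
      using profileD(1,2)[OF A, of n] profileD(1,2)[OF A, of n'] by (simp_all add: eq_nat_nat_iff)
    then show "n = n'" by simp
  qed
  then show "card (strip l A x) = l" by (simp add: strip_def card_image)
  have e: "{x - int l<..x} = {x - int l + 1..x}" by auto
  show "connected_boxes (strip l A x)"
    unfolding strip_def e
  proof (rule connected_boxes_chain)
    fix n assume n: "x - int l + 1 \<le> n" "n < x"
    show "share_edge (?f n) (?f (n + 1))"
    proof (cases "n \<in> beads A")
      case True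
      then have "A (n + 1) = A n - 1" by (rule profile_beadD[OF A])
      then show ?thesis
        using strip_pos[OF A m, of n] n unfolding share_edge_def by simp linarith
    next
      case False
      then have "A (n + 1) = A n" by (rule profile_gapD[OF A])
      then show ?thesis
        using strip_pos[OF A m, of n] n unfolding share_edge_def by simp linarith
    qed
  qed
  \<comment> \<open>A \<open>2 \<times> 2\<close> square has two boxes on one diagonal, a strip only
    one.\<close>
  show "\<not> (\<exists>a b. {(a, b), (Suc a, b), (a, Suc b), (Suc a, Suc b)} \<subseteq> strip l A x)"
  proof clarify
    fix a b assume "{(a, b), (Suc a, b), (a, Suc b), (Suc a, Suc b)} \<subseteq> strip l A x"
    then have "(a, b) \<in> strip l A x" "(Suc a, Suc b) \<in> strip l A x" by blast+
    then show False unfolding mem_strip[OF A] by simp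
  qed
  have "finite (D - strip l A x)" using lower_setD(1)[OF D] by simp
  then show "young_diagram (D - strip l A x)"
    using profile_lowered[OF A m l] young_diagram_iff_profile by blast
qed

text \<open>A discrete intermediate value argument: crossing an edge changes \<open>b - a\<close> by
  one.\<close>

lemma connected_boxes_contents:
  assumes R: "connected_boxes R" and u: "(a, b) \<in> R" "int b - int a \<le> n"
    and v: "(c, d) \<in> R" "n \<le> int d - int c"
  shows "\<exists>a' b'. (a', b') \<in> R \<and> int b' - int a' = n"
proof -
  have "\<exists>s\<in>R. int (snd s) - int (fst s) = n"
    if "(\<lambda>s t. s \<in> R \<and> t \<in> R \<and> share_edge s t)\<^sup>*\<^sup>* (a, b) t" "n \<le> int (snd t) - int (fst t)" for t
    using that
  proof (induction rule: rtranclp_induct)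
    case base
    then show ?case using u by (intro bexI[of _ "(a, b)"]) simp_all
  next
    case (step s t)
    show ?case
    proof (cases "n \<le> int (snd s) - int (fst s)")
      case True
      then show ?thesis using step by blast
    next
      case False
      then have "int (snd t) - int (fst t) = n"
        using step by (auto simp: share_edge_def)
      then show ?thesis using step by blast
    qed
  qed
  moreover have "(\<lambda>s t. s \<in> R \<and> t \<in> R \<and> share_edge s t)\<^sup>*\<^sup>* (a, b) (c, d)"
    using R u v unfolding connected_boxes_def by blast
  ultimately show ?thesis using v by fastforce
qed

text \<open>A rim box is the last one on its diagonal, so a hook has at most one box per diagonal;
  by connectedness its diagonals form an interval of length \<open>l\<close>, and \<open>x\<close>
  is the largest.\<close>

lemma removable_imp_strip:
  assumes D: "lower_set D" and A: "profile D A" and l: "l \<noteq> 0" and R: "removable_rim_hook l D R"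
  obtains x where "movable l (beads A) x" "R = strip l A x"
proof -
  let ?c = "\<lambda>s. int (snd s) - int (fst s)"
  have R': "R \<subseteq> rim D" "finite R" "card R = l" "connected_boxes R" "young_diagram (D - R)"
    using R unfolding removable_rim_hook_def by blast+
  have RA: "int a = A (int b - int a)" "1 \<le> a" "1 \<le> b" if "(a, b) \<in> R" for a b
  proof -
    have "(a, b) \<in> D" "(Suc a, Suc b) \<notin> D" using R'(1) that by (auto simp: rim_def)
    then show "int a = A (int b - int a)" "1 \<le> a" "1 \<le> b" by (simp_all add: profile_mem[OF A])
  qed
  define C where "C = ?c ` R"
  have "inj_on ?c R"
  proof (rule inj_onI; clarify)
    fix a b a' b' assume "(a, b) \<in> R" "(a', b') \<in> R" "?c (a, b) = ?c (a', b')"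
    then show "a = a' \<and> b = b'" using RA(1)[of a b] RA(1)[of a' b'] by simp
  qed
  then have cC: "card C = l" using R'(3) by (simp add: C_def card_image)
  have C: "finite C" "C \<noteq> {}" using R'(2) cC l by (auto simp: C_def)
  have memC: "n \<in> C \<longleftrightarrow> (\<exists>a b. (a, b) \<in> R \<and> int b - int a = n)" for n
    by (force simp: C_def)
  define x where "x = Max C"
  have Ceq: "C = {Min C..x}"
  proof
    show "C \<subseteq> {Min C..x}" using C by (auto simp: x_def)
    show "{Min C..x} \<subseteq> C"
    proof
      fix n assume n: "n \<in> {Min C..x}"
      have "Min C \<in> C" "x \<in> C" using C by (auto simp: x_def)
      then show "n \<in> C"
        using connected_boxes_contents[OF R'(4)] n unfolding memC by (metis atLeastAtMost_iff)
    qed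
  qed
  have "l = nat (x - Min C + 1)"
    using arg_cong[OF Ceq, of card] unfolding cC card_atLeastAtMost_int by simp
  then have "Min C = x - int l + 1" using l by simp
  then have Ci: "n \<in> C \<longleftrightarrow> x - int l < n \<and> n \<le> x" for n
    using Ceq by (metis add1_zle_eq atLeastAtMost_iff)
  have RS: "R = strip l A x"
  proof (intro set_eqI; clarify)
    fix a b
    show "(a, b) \<in> R \<longleftrightarrow> (a, b) \<in> strip l A x"
    proof
      assume ab: "(a, b) \<in> R"
      then have "int b - int a \<in> C" unfolding memC by blast
      then show "(a, b) \<in> strip l A x" using RA(1)[OF ab] unfolding Ci mem_strip[OF A] by simp
    next
      assume "(a, b) \<in> strip l A x"
      then have *: "int b - int a \<in> C" "int a = A (int b - int a)"
        unfolding Ci mem_strip[OF A] by simp_all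
      then obtain a' b' where ab': "(a', b') \<in> R" "int b' - int a' = int b - int a"
        unfolding memC by blast
      then have "a' = a" using RA(1)[OF ab'(1)] * by simp
      then show "(a, b) \<in> R" using ab' by simp
    qed
  qed
  obtain A' where A': "profile (D - R) A'"
    using R'(5) unfolding young_diagram_iff_profile by blast
  \<comment> \<open>What remains is again a diagram, and its profile must be
    \<open>lowered l A x\<close>.\<close>
  have A'_eq: "A' n = lowered l A x n" for n
  proof (rule profile_diagonal_unique[of _ n])
    show "0 \<le> A' n" "0 \<le> A' n + n" using profileD[OF A'] by blast+
    have "1 \<le> A n \<and> 1 \<le> A n + n" if n: "n \<in> C"
    proof -
      obtain a b where ab: "(a, b) \<in> R" "int b - int a = n" using n unfolding memC by blast
      then show ?thesis using RA[OF ab(1)] by auto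
    qed
    then show "0 \<le> lowered l A x n" "0 \<le> lowered l A x n + n"
      using profileD(1,2)[OF A, of n] unfolding lowered_def Ci by auto
    fix a b assume ab: "int b - int a = n" "1 \<le> a" "1 \<le> b"
    have "int a \<le> A' n \<longleftrightarrow> (a, b) \<in> D - R" using ab unfolding profile_mem[OF A'] by simp
    also have "\<dots> \<longleftrightarrow> int a \<le> lowered l A x n"
      unfolding RS Diff_iff profile_mem[OF A] mem_strip[OF A] lowered_def using ab by auto
    finally show "int a \<le> A' n \<longleftrightarrow> int a \<le> lowered l A x n" .
  qed
  \<comment> \<open>A profile never rises and drops by at most one. After lowering, this forces a
    bead at \<open>x\<close> and a gap at \<open>x - int l\<close>.\<close>
  have "x \<in> beads A"
    using profileD(3)[OF A', of x] l by (simp add: A'_eq lowered_def beads_def)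
  moreover have "x - int l \<notin> beads A"
    using profileD(4)[OF A', of "x - int l"] l by (simp add: A'_eq lowered_def beads_def)
  ultimately show ?thesis using that RS unfolding movable_def by blast
qed

section \<open>Direction and adjacency of strips\<close>

text \<open>Along the strip a gap keeps the row and a bead changes it. The steps between its
  \<open>l\<close> boxes are those strictly between \<open>x - int l\<close> and
  \<open>x\<close>.\<close>

lemma horizontal_strip:
  assumes A: "profile D A"
  shows "horizontal (strip l A x) \<longleftrightarrow> over_gaps l (beads A) x"
proof
  assume "horizontal (strip l A x)"
  then have "\<exists>a. \<forall>n\<in>{x - int l<..x}. nat (A n) = a"
    unfolding horizontal_def strip_def by auto
  then obtain a where a: "\<And>n. x - int l < n \<Longrightarrow> n \<le> x \<Longrightarrow> nat (A n) = a" by auto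
  show "over_gaps l (beads A) x"
    unfolding over_gaps_def
  proof (intro allI impI)
    fix n assume "x - int l < n \<and> n < x"
    then have "nat (A n) = nat (A (n + 1))" using a[of n] a[of "n + 1"] by simp
    then show "n \<notin> beads A"
      using profileD(1)[OF A, of n] profileD(1)[OF A, of "n + 1"] by (simp add: beads_def)
  qed
next
  assume g: "over_gaps l (beads A) x"
  have step: "x - int l < x - int k \<Longrightarrow> A (x - int k) = A x" for k
  proof (induction k)
    case (Suc k)
    then have "x - int (Suc k) \<notin> beads A" using g by (simp add: over_gaps_def)
    from profile_gapD[OF A this] show ?case using Suc by simp
  qed simp
  have eq: "A n = A x" if "x - int l < n" "n \<le> x" for n
    using step[of "nat (x - n)"] that by simp
  then show "horizontal (strip l A x)"
    unfolding horizontal_def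
  proof (intro exI ballI)
    fix u assume "u \<in> strip l A x"
    moreover obtain a b where u: "u = (a, b)" by (cases u)
    ultimately have ab: "x - int l < int b - int a" "int b - int a \<le> x"
        "int a = A (int b - int a)"
      unfolding u mem_strip[OF A] by blast+
    then have "int a = A x" using eq[OF ab(1,2)] by linarith
    then show "fst u = nat (A x)" unfolding u by simp
  qed
qed

lemma vertical_strip:
  assumes A: "profile D A"
  shows "vertical (strip l A x) \<longleftrightarrow> over_beads l (beads A) x"
proof
  assume "vertical (strip l A x)"
  then have "\<exists>a. \<forall>n\<in>{x - int l<..x}. nat (A n + n) = a"
    unfolding vertical_def strip_def by auto
  then obtain a where a: "\<And>n. x - int l < n \<Longrightarrow> n \<le> x \<Longrightarrow> nat (A n + n) = a" by auto
  show "over_beads l (beads A) x"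
    unfolding over_beads_def
  proof (intro allI impI)
    fix n assume "x - int l < n \<and> n < x"
    then have "nat (A n + n) = nat (A (n + 1) + (n + 1))" using a[of n] a[of "n + 1"] by simp
    then show "n \<in> beads A"
      using profileD(2)[OF A, of n] profileD(2)[OF A, of "n + 1"] by (simp add: beads_def)
  qed
next
  assume g: "over_beads l (beads A) x"
  have step: "x - int l < x - int k \<Longrightarrow> A (x - int k) + (x - int k) = A x + x" for k
  proof (induction k)
    case (Suc k)
    then have "x - int (Suc k) \<in> beads A" using g by (simp add: over_beads_def)
    from profile_beadD[OF A this] show ?case using Suc by simp
  qed simp
  have eq: "A n + n = A x + x" if "x - int l < n" "n \<le> x" for n
    using step[of "nat (x - n)"] that by simp
  then show "vertical (strip l A x)"
    unfolding vertical_def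
  proof (intro exI ballI)
    fix u assume "u \<in> strip l A x"
    moreover obtain a b where u: "u = (a, b)" by (cases u)
    ultimately have ab: "x - int l < int b - int a" "int b - int a \<le> x"
        "int a = A (int b - int a)"
      unfolding u mem_strip[OF A] by blast+
    then have "int b = A x + x" using eq[OF ab(1,2)] by linarith
    then show "snd u = nat (A x + x)" unfolding u by simp
  qed
qed

text \<open>Reduces adjacency to neighbouring diagonals, which is what the abacus argument can
  see.\<close>

lemma adjacent_strips_contents:
  assumes A: "profile D A" and A': "profile D' A'" and "adjacent (strip l A x) (strip l A' z)"
  obtains n m where "x - int l < n" "n \<le> x" "z - int l < m" "m \<le> z" "n = m + 1 \<or> m = n + 1"
proof -
  obtain a b c d where *: "(a, b) \<in> strip l A x" "(c, d) \<in> strip l A' z" "share_edge (a, b) (c, d)"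
    using assms(3) unfolding adjacent_def by auto
  then show thesis
    by (intro that[of "int b - int a" "int d - int c"])
      (auto simp: mem_strip[OF A] mem_strip[OF A'] share_edge_def)
qed

text \<open>The pair \<open>x\<close>, \<open>x - 2 * int l\<close> violates the condition: of the
  two positions \<open>x - 1\<close> and \<open>x - 2 * int l + 1\<close> off its runner, one
  supplies the gap and the other the bead.\<close>

lemma abacus_JM_no_double_gap:
  assumes l: "l \<ge> 3" and J: "abacus_JM l B" and x: "x \<in> B" "x - 2 * int l \<notin> B"
    and "x - 2 * int l + 1 \<notin> B \<and> x - 1 \<in> B \<or> x - 1 \<notin> B \<and> x - 2 * int l + 1 \<in> B"
  shows False
proof -
  have n1: "\<not> int l dvd 1" using l by simp
  have n2: "\<not> int l dvd 2 * int l - 1"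
  proof
    assume "int l dvd 2 * int l - 1"
    from dvd_diff[OF dvd_triv_right[of "int l" 2] this] show False using n1 by simp
  qed
  note c = abacus_JM_contra[OF J x]
  have d: "x - 2 * int l < x" "int l dvd x - (x - 2 * int l)" using l by simp_all
  have e: "x - (x - 2 * int l + 1) = 2 * int l - 1" "x - 1 - (x - 2 * int l) = 2 * int l - 1"
    "x - (x - 1) = 1" "x - 2 * int l + 1 - (x - 2 * int l) = 1" by simp_all
  have lt: "x - 2 * int l + 1 < x" "x - 2 * int l < x - 1" "x - 1 < x"
    "x - 2 * int l < x - 2 * int l + 1" using l by simp_all
  from assms(5) show False
    using c[OF d lt(1) _ _ lt(2), unfolded e] c[OF d lt(3) _ _ lt(4), unfolded e] n1 n2 by blast
qed

text \<open>Windows of moves in different directions cannot overlap. If they touch, they form a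
  stretch of length \<open>2 * int l\<close> with gaps in one half and beads in the other, which
  \<open>abacus_JM_no_double_gap\<close> forbids.\<close>

lemma abacus_JM_not_adjacent:
  assumes l: "l \<ge> 3" and J: "abacus_JM l B" and x: "movable l B x" and z: "movable l (move l B x) z"
    and dir: "over_beads l B x \<and> over_gaps l (move l B x) z \<or>
      over_gaps l B x \<and> over_beads l (move l B x) z"
    and nm: "x - int l < n" "n \<le> x" "z - int l < m" "m \<le> z" "n = m + 1 \<or> m = n + 1"
  shows False
proof -
  have mv: "k \<in> move l B x \<longleftrightarrow> k = x - int l \<or> k \<in> B \<and> k \<noteq> x" for k
    unfolding move_def by blast
  have xB: "x \<in> B" "x - int l \<notin> B" using x by (auto simp: movable_def)
  have zB: "z \<in> move l B x" "z - int l \<notin> move l B x" using z by (auto simp: movable_def)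
  from dir show False
  proof
    assume d: "over_beads l B x \<and> over_gaps l (move l B x) z"
    have b: "k \<in> B" if "x - int l < k" "k < x" for k
      using d that by (simp add: over_beads_def)
    have g: "k \<notin> B \<and> k \<noteq> x - int l \<or> k = x" if "z - int l \<le> k" "k < z" for k
    proof (cases "k = z - int l")
      case True
      then show ?thesis using zB unfolding mv by simp
    next
      case False
      then have "k \<notin> move l B x" using d that unfolding over_gaps_def by simp
      then show ?thesis using mv by blast
    qed
    \<comment> \<open>With an overlap, \<open>x - int l\<close> or \<open>z - int l\<close> would be
      both bead and gap after the first move.\<close>
    have "z \<le> x - int l \<or> x \<le> z - int l"
    proof (rule ccontr)
      assume *: "\<not> (z \<le> x - int l \<or> x \<le> z - int l)"
      show False
      proof (cases "z - int l \<le> x - int l")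
        case True
        then show ?thesis using g[of "x - int l"] * l by simp
      next
        case False
        then show ?thesis using g[of "z - int l"] b[of "z - int l"] * l by simp
      qed
    qed
    then consider "z = x - int l" | "z = x + int l" using nm by linarith
    then show False
    proof cases
      case 1
      then show False
        using abacus_JM_no_double_gap[OF l J, of x] xB l b[of "x - 1"]
          g[of "x - 2 * int l"] g[of "x - 2 * int l + 1"] by simp
    next
      case 2
      have e: "x + int l - 2 * int l = x - int l" by simp
      have "x + int l \<in> B" using zB(1) 2 l unfolding mv by simp
      then show False
        using abacus_JM_no_double_gap[OF l J, of "x + int l"] 2 xB l b[of "x - int l + 1"]
          g[of "x + int l - 1"] unfolding e by simp
    qed
  next
    assume d: "over_gaps l B x \<and> over_beads l (move l B x) z"
    have g: "k \<notin> B" if "x - int l \<le> k" "k < x" for k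
      using d xB that unfolding over_gaps_def by (cases "k = x - int l") auto
    have b: "k = x - int l \<or> k \<in> B \<and> k \<noteq> x" if "z - int l < k" "k \<le> z" for k
    proof (cases "k = z")
      case True
      then show ?thesis using zB unfolding mv by simp
    next
      case False
      then have "k \<in> move l B x" using d that unfolding over_beads_def by simp
      then show ?thesis using mv by blast
    qed
    \<comment> \<open>Here the contradictory position is \<open>z\<close> itself or the vacated
      \<open>x\<close>.\<close>
    have "z \<le> x - int l \<or> x \<le> z - int l"
    proof (rule ccontr)
      assume *: "\<not> (z \<le> x - int l \<or> x \<le> z - int l)"
      show False
      proof (cases "z \<le> x")
        case True
        then show ?thesis using b[of z] g[of z] * l by auto
      next
        case False
        then show ?thesis using b[of x] * l by simp
      qed
    qed
    then consider "z = x - int l" | "z = x + int l" using nm by linarith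
    then show False
    proof cases
      case 1
      have "x - 2 * int l \<notin> B" using zB(2) l 1 unfolding mv by simp
      moreover have "x - 1 \<notin> B" using g[of "x - 1"] l by simp
      moreover have "x - 2 * int l + 1 \<in> B" using b[of "x - 2 * int l + 1"] l 1 by simp
      ultimately show False
        using abacus_JM_no_double_gap[OF l J xB(1)] by blast
    next
      case 2
      have e: "x + int l - 2 * int l = x - int l" by simp
      show False
        using abacus_JM_no_double_gap[OF l J, of "x + int l"] 2 xB l g[of "x - int l + 1"]
          b[of "x + int l"] b[of "x + int l - 1"] unfolding e by simp
    qed
  qed
qed

section \<open>From the JM condition to generalized partitions\<close>

lemma JM_imp_hooks_straight:
  assumes l: "l \<noteq> 0" and D: "lower_set D" and J: "JM_partition l D"
  shows "hooks_straight l D"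
  unfolding hooks_straight_def
proof (intro allI impI)
  fix R assume R: "removable_rim_hook l D R"
  obtain A where A: "profile D A" using profile_exists[OF D] by blast
  obtain x where x: "movable l (beads A) x" "R = strip l A x"
    using removable_imp_strip[OF D A l R] by blast
  have "abacus_straight l (beads A)"
    using J l by (intro abacus_JM_imp_straight) (simp_all add: JM_partition_iff_abacus_JM[OF D A])
  then show "horizontal R \<or> vertical R"
    using x unfolding abacus_straight_def x(2) horizontal_strip[OF A] vertical_strip[OF A] by blast
qed

lemma JM_imp_hooks_nonadjacent:
  assumes l: "l \<ge> 3" and D: "lower_set D" and J: "JM_partition l D"
  shows "hooks_nonadjacent l D"
  unfolding hooks_nonadjacent_def
proof (intro allI impI notI)
  fix R S
  assume *: "removable_rim_hook l D R \<and> removable_rim_hook l (D - R) S \<and>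
    (vertical R \<and> horizontal S \<or> horizontal R \<and> vertical S)" and adj: "adjacent R S"
  have l0: "l \<noteq> 0" using l by simp
  obtain A where A: "profile D A" using profile_exists[OF D] by blast
  obtain x where x: "movable l (beads A) x" "R = strip l A x"
    using removable_imp_strip[OF D A l0] * by blast
  define A' where "A' = lowered l A x"
  have A': "profile (D - R) A'" unfolding A'_def x(2) by (rule profile_lowered[OF A x(1) l0])
  have D': "lower_set (D - R)"
    using profile_lower_set[OF A'] lower_setD(1)[OF D] by simp
  have B': "beads A' = move l (beads A) x"
    unfolding A'_def by (rule beads_lowered[OF A x(1) l0])
  obtain z where z: "movable l (beads A') z" "S = strip l A' z"
    using removable_imp_strip[OF D' A' l0] * by blast
  obtain n m where nm: "x - int l < n" "n \<le> x" "z - int l < m" "m \<le> z" "n = m + 1 \<or> m = n + 1"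
    using adjacent_strips_contents[OF A A'] adj unfolding x(2) z(2) by metis
  have dir: "over_beads l (beads A) x \<and> over_gaps l (beads A') z \<or>
      over_gaps l (beads A) x \<and> over_beads l (beads A') z"
    using * unfolding x(2) z(2) horizontal_strip[OF A] vertical_strip[OF A]
      horizontal_strip[OF A'] vertical_strip[OF A'] by blast
  show False
    using abacus_JM_not_adjacent[OF l _ x(1) z(1)[unfolded B'] dir[unfolded B'] nm] J
    unfolding JM_partition_iff_abacus_JM[OF D A] by blast
qed

lemma JM_remove_straight_hook:
  assumes l: "l \<noteq> 0" and D: "lower_set D" and J: "JM_partition l D" and E: "remove_straight_hook l D E"
  shows "lower_set E \<and> JM_partition l E"
proof -
  obtain R where R: "removable_rim_hook l D R" "E = D - R"
    using E unfolding remove_straight_hook_def by blast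
  obtain A where A: "profile D A" using profile_exists[OF D] by blast
  obtain x where x: "movable l (beads A) x" "R = strip l A x"
    using removable_imp_strip[OF D A l R(1)] by blast
  have A': "profile E (lowered l A x)" unfolding R(2) x(2) by (rule profile_lowered[OF A x(1) l])
  have E': "lower_set E"
    using profile_lower_set[OF A'] lower_setD(1)[OF D] R(2) by simp
  moreover have "JM_partition l E"
    unfolding JM_partition_iff_abacus_JM[OF E' A'] beads_lowered[OF A x(1) l]
    using J abacus_JM_move[OF _ x(1) l] unfolding JM_partition_iff_abacus_JM[OF D A] by blast
  ultimately show ?thesis by blast
qed

lemma JM_imp_generalized:
  assumes l: "l \<ge> 3" and D: "lower_set D" and J: "JM_partition l D"
  shows "generalized_partition l D"
proof -
  have "lower_set E \<and> JM_partition l E" if "(remove_straight_hook l)\<^sup>*\<^sup>* D E" for E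
    using that
  proof (induction rule: rtranclp_induct)
    case (step E F)
    then show ?case using JM_remove_straight_hook[of l E F] l by simp
  qed (use D J in simp)
  then have "hooks_straight l E \<and> hooks_nonadjacent l E"
    if "(remove_straight_hook l)\<^sup>*\<^sup>* D E" for E
    using that JM_imp_hooks_straight[of l E] JM_imp_hooks_nonadjacent[OF l, of E] l by simp
  then show ?thesis unfolding generalized_partition_def by blast
qed

section \<open>From generalized partitions to the JM condition\<close>

text \<open>If \<open>x - int l\<close> is a bead, it moves first, vertically, and \<open>x\<close>
  follows horizontally into its place; if it is a gap, \<open>x\<close> moves there horizontally and
  then on vertically. The strips touch across diagonals \<open>x - int l\<close> and
  \<open>x - int l + 1\<close>.\<close>

lemma cross_pattern_imp_adjacent:
  assumes l: "l \<noteq> 0" and D: "lower_set D" and A: "profile D A"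
    and cr: "cross_pattern l (beads A) x"
  shows "\<not> hooks_nonadjacent l D"
proof -
  let ?B = "beads A"
  have *: "x \<in> ?B" "x - 2 * int l \<notin> ?B" "over_gaps l ?B x" "over_beads l ?B (x - int l)"
    using cr by (simp_all add: cross_pattern_def)
  have contra: "\<not> hooks_nonadjacent l D"
    if w: "movable l ?B w" and z: "movable l (move l ?B w) z"
      and dir: "over_beads l ?B w \<and> over_gaps l (move l ?B w) z \<or>
        over_gaps l ?B w \<and> over_beads l (move l ?B w) z"
      and adj: "adjacent (strip l A w) (strip l (lowered l A w) z)" for w z
  proof -
    note A' = profile_lowered[OF A w l] and B' = beads_lowered[OF A w l]
    have D': "lower_set (D - strip l A w)"
      using profile_lower_set[OF A'] lower_setD(1)[OF D] by simp
    have "removable_rim_hook l D (strip l A w)" by (rule strip_removable[OF D A w l])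
    moreover have "removable_rim_hook l (D - strip l A w) (strip l (lowered l A w) z)"
      by (rule strip_removable[OF D' A' z[folded B'] l])
    ultimately show ?thesis
      using adj dir unfolding hooks_nonadjacent_def B'[symmetric] horizontal_strip[OF A, symmetric]
        vertical_strip[OF A, symmetric] horizontal_strip[OF A', symmetric]
        vertical_strip[OF A', symmetric] by blast
  qed
  have adjI: "adjacent R S" if "u \<in> R" "v \<in> S" "share_edge u v" for R S u v
    using that unfolding adjacent_def by blast
  show ?thesis
  proof (cases "x - int l \<in> ?B")
    case True
    then have m: "movable l ?B (x - int l)" using * by (simp add: movable_def)
    let ?A' = "lowered l A (x - int l)"
    have a: "A (x - int l + 1) = A (x - int l) - 1" using True by (rule profile_beadD[OF A])
    note pos = strip_pos[OF A m, of "x - int l"]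
    show ?thesis
    proof (rule contra[OF m, of x])
      show "movable l (move l ?B (x - int l)) x" using * l by (auto simp: movable_def move_def)
      show "over_beads l ?B (x - int l) \<and> over_gaps l (move l ?B (x - int l)) x \<or>
        over_gaps l ?B (x - int l) \<and> over_beads l (move l ?B (x - int l)) x"
        using * l by (auto simp: over_gaps_def move_def)
      show "adjacent (strip l A (x - int l)) (strip l ?A' x)"
      proof (rule adjI)
        let ?n = "x - int l"
        show "(nat (A ?n), nat (A ?n + ?n)) \<in> strip l A ?n"
          using l by (auto simp: strip_def)
        show "(nat (?A' (?n + 1)), nat (?A' (?n + 1) + (?n + 1))) \<in> strip l ?A' x"
          unfolding strip_def using l by (intro image_eqI[of _ _ "?n + 1"]) auto
        show "share_edge (nat (A ?n), nat (A ?n + ?n))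
          (nat (?A' (?n + 1)), nat (?A' (?n + 1) + (?n + 1)))"
          using a pos l by (auto simp: share_edge_def lowered_def algebra_simps)
      qed
    qed
  next
    case False
    then have m: "movable l ?B x" using * by (simp add: movable_def)
    let ?A' = "lowered l A x"
    have a: "A (x - int l + 1) = A (x - int l)" using False by (rule profile_gapD[OF A])
    note pos = strip_pos[OF A m, of "x - int l + 1"]
    show ?thesis
    proof (rule contra[OF m, of "x - int l"])
      show "movable l (move l ?B x) (x - int l)" using * l by (auto simp: movable_def move_def)
      show "over_beads l ?B x \<and> over_gaps l (move l ?B x) (x - int l) \<or>
        over_gaps l ?B x \<and> over_beads l (move l ?B x) (x - int l)"
        using * l by (auto simp: over_beads_def move_def)
      show "adjacent (strip l A x) (strip l ?A' (x - int l))"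
      proof (rule adjI)
        let ?n = "x - int l"
        show "(nat (A (?n + 1)), nat (A (?n + 1) + (?n + 1))) \<in> strip l A x"
          unfolding strip_def using l by (intro image_eqI[of _ _ "?n + 1"]) auto
        show "(nat (?A' ?n), nat (?A' ?n + ?n)) \<in> strip l ?A' ?n"
          using l by (auto simp: strip_def)
        show "share_edge (nat (A (?n + 1)), nat (A (?n + 1) + (?n + 1)))
          (nat (?A' ?n), nat (?A' ?n + ?n))"
          using a pos l by (auto simp: share_edge_def lowered_def algebra_simps)
      qed
    qed
  qed
qed

text \<open>Conditions (1) and (2) supply the hypotheses of \<open>nonJM_pair\<close>. The removal
  it yields keeps a violation, while condition (3) and induction make the smaller diagram
  JM.\<close>

lemma generalized_imp_JM:
  assumes l: "l \<ge> 3" and "lower_set D" and "generalized_partition l D"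
  shows "JM_partition l D"
  using assms(2,3)
proof (induction "card D" arbitrary: D rule: less_induct)
  case less
  note D = less.prems(1) and gen = less.prems(2)
  have l0: "l \<noteq> 0" using l by simp
  obtain A where A: "profile D A" using profile_exists[OF D] by blast
  let ?B = "beads A"
  have st: "abacus_straight l ?B"
    using gen strip_removable[OF D A _ l0] horizontal_strip[OF A] vertical_strip[OF A]
    unfolding generalized_partition_def hooks_straight_def abacus_straight_def by blast
  have cr: "\<not> cross_pattern l ?B x" for x
    using gen cross_pattern_imp_adjacent[OF l0 D A] unfolding generalized_partition_def by blast
  have "abacus_JM l ?B"
  proof (rule ccontr)
    assume "\<not> abacus_JM l ?B"
    then obtain z where z: "movable l ?B z" "over_gaps l ?B z \<or> over_beads l ?B z"
      "\<not> abacus_JM l (move l ?B z)"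
      using nonJM_pair[OF l st cr] unfolding abacus_JM_def by blast
    define E where "E = D - strip l A z"
    have rem: "removable_rim_hook l D (strip l A z)" by (rule strip_removable[OF D A z(1) l0])
    have step: "remove_straight_hook l D E"
      using rem z(2) unfolding remove_straight_hook_def E_def horizontal_strip[OF A, symmetric]
        vertical_strip[OF A, symmetric] by blast
    have A': "profile E (lowered l A z)" unfolding E_def by (rule profile_lowered[OF A z(1) l0])
    have finD: "finite D" by (rule lower_setD(1)[OF D])
    then have E: "lower_set E" using profile_lower_set[OF A'] by (simp add: E_def)
    have "strip l A z \<subseteq> D" "card (strip l A z) = l"
      using rem unfolding removable_rim_hook_def rim_def by auto
    then have "E \<subset> D" using l unfolding E_def by (cases "strip l A z = {}") auto
    then have "card E < card D" using finD psubset_card_mono by blast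
    moreover have "generalized_partition l E"
      using gen step converse_rtranclp_into_rtranclp[of "remove_straight_hook l" D E]
      unfolding generalized_partition_def by blast
    ultimately have "JM_partition l E" using less.hyps E by blast
    then show False
      using z(3) unfolding JM_partition_iff_abacus_JM[OF E A'] beads_lowered[OF A z(1) l0] by blast
  qed
  then show ?case unfolding JM_partition_iff_abacus_JM[OF D A] .
qed

theorem theorem2p7:
  fixes l :: nat and p :: "nat list"
  assumes "l \<ge> 3" and "is_partition p"
  shows "JM_partition l (diagram p) \<longleftrightarrow> generalized_partition l (diagram p)"
proof -
  have "lower_set (diagram p)"
    using assms(2) unfolding young_diagram_iff_lower_set[symmetric] young_diagram_def by blast
  then show ?thesis using JM_imp_generalized generalized_imp_JM assms(1) by blast
qed

end
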